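(* Let $f_1,\ldots,f_N:\mathbb{R}^n\to\mathbb{R}$, $D_1,\ldots,D_N:\mathbb{R}^n\rightrightarrows\mathbb{R}^n$ and $g:\mathbb{R}^n\to\overline{\mathbb{R}}$ satisfy the standing assumption stated in the context, with $\Phi:=f_1+\cdots+f_N+g$ and $D_\Phi:=D_1+\cdots+D_N+\partial g$. Let $\delta,\epsilon>0$. For any bounded set $X_0\subset\operatorname{dom}\Phi$, there exists $\bar\alpha>0$ such that for any sequence $(x_k)_{k\in\mathbb{N}}$ generated by proximal random reshuffling (PRR) initialized in $X_0$ with step sizes satisfying $$\alpha_k\in(0,\bar\alpha]\ \ \text{for all } k\in\mathbb{N}\quad\text{and}\quad \sum_{k=0}^\infty\alpha_k=\infty,$$ at least one iterate $x_k$ is $(\epsilon,\delta)$-near approximate $D_\Phi$-stationary.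
   Context: Notation: $\mathbb{R}^n$ carries an inner product $\langle\cdot,\cdot\rangle$ with induced norm $\|\cdot\|$; $\overline{\mathbb{R}}=\mathbb{R}\cup\{\pm\infty\}$; $\mathbb{N}=\{0,1,2,\ldots\}$; $\operatorname{dom}\Phi=\{x:\Phi(x)<\infty\}$; $B(x,r)$ is the closed ball of radius $r$ centered at $x$; $d(x,S)=\inf\{\|x-y\|:y\in S\}$ (equal to $+\infty$ if $S=\emptyset$); for a set-valued map $D$, $D(S)=\bigcup_{x\in S}D(x)$. $D$ is locally bounded if every point has a neighborhood $U$ with $D(U)$ bounded. Conservative field: for a locally Lipschitz $f:\mathbb{R}^n\to\mathbb{R}$, a set-valued map $D:\mathbb{R}^n\rightrightarrows\mathbb{R}^n$ with closed graph and nonempty compact values is a conservative field for $f$ if for every absolutely continuous curve $\gamma:[0,1]\to\mathbb{R}^n$, for almost every $t\in[0,1]$, $\frac{d}{dt}f(\gamma(t))=\langle v,\gamma'(t)\rangle$ for all $v\in D(\gamma(t))$. Standing assumption: (1) $f_1,\ldots,f_N:\mathbb{R}^n\to\mathbb{R}$ ($N\geqslant 1$) are locally Lipschitz; (2) for each $i$, $D_i:\mathbb{R}^n\rightrightarrows\mathbb{R}^n$ is a locally bounded conservative field with nonempty convex values for $f_i$; (3) $g:\mathbb{R}^n\to\overline{\mathbb{R}}$ is proper and convex, its domain is closed, and $g$ is locally Lipschitz on its domain; (4) $\Phi:=f+g$ is bounded below, where $f:=f_1+\cdots+f_N$, and $D_\Phi:=\sum_{i=1}^N D_i+\partial g$,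 where $\partial g$ is the convex subdifferential of $g$. PRR algorithm: given step sizes $\alpha_0,\alpha_1,\ldots>0$ and $x_0\in\operatorname{dom}\Phi$, for $k=0,1,2,\ldots$: set $x_{k,0}=x_k$; choose an arbitrary permutation $\sigma^k$ of $\{1,\ldots,N\}$; for $i=1,\ldots,N$ choose $x_{k,i}\in x_{k,i-1}-\alpha_k D_{\sigma^k_i}(x_{k,i-1})$; set $x_{k+1}=\operatorname{prox}_{\alpha_k g}(x_{k,N})$, where $\operatorname{prox}_{h}(x)=\operatorname{argmin}_{y\in\mathbb{R}^n}\{h(y)+\|y-x\|^2/2\}$. "Initialized in $X_0$" means $x_0\in X_0$. Near approximate stationarity: for $\epsilon,\delta\geqslant0$ and $D:\mathbb{R}^n\rightrightarrows\mathbb{R}^n$, a point $x$ is $(\epsilon,\delta)$-near approximate $D$-stationary if $d(0,D(B(x,\epsilon)))\leqslant\delta$. *)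

theory Defs
  imports "HOL-Analysis.Analysis"
begin

text \<open>The space \<open>\<real>\<^sup>n\<close> with its inner product is an arbitrary type of class \<open>euclidean_space\<close>.\<close>

definition effective_domain :: "('a \<Rightarrow> ereal) \<Rightarrow> 'a set" where
  "effective_domain h = {x. h x < \<infinity>}"

definition proper_ereal :: "('a \<Rightarrow> ereal) \<Rightarrow> bool" where
  "proper_ereal h \<longleftrightarrow> (\<forall>x. h x \<noteq> -\<infinity>) \<and> effective_domain h \<noteq> {}"

text \<open>Convexity of an extended-real-valued function means convexity of its epigraph,
  a subset of \<open>\<real>\<^sup>n \<times> \<real>\<close>.\<close>

definition convex_ereal :: "('a::real_vector \<Rightarrow> ereal) \<Rightarrow> bool" where
  "convex_ereal h \<longleftrightarrow> convex {(x, r::real). h x \<le> ereal r}"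

definition locally_lipschitz_on :: "'a::metric_space set \<Rightarrow> ('a \<Rightarrow> 'b::metric_space) \<Rightarrow> bool" where
  "locally_lipschitz_on S h \<longleftrightarrow>
     (\<forall>x\<in>S. \<exists>r>0. \<exists>L. L-lipschitz_on (cball x r \<inter> S) h)"

definition locally_bounded_map :: "('a::topological_space \<Rightarrow> 'b::metric_space set) \<Rightarrow> bool" where
  "locally_bounded_map D \<longleftrightarrow> (\<forall>x. \<exists>U. open U \<and> x \<in> U \<and> bounded (\<Union> (D ` U)))"

definition abs_continuous_curve :: "real \<Rightarrow> real \<Rightarrow> (real \<Rightarrow> 'a::metric_space) \<Rightarrow> bool" where
  "abs_continuous_curve s t \<gamma> \<longleftrightarrow>
     (\<forall>e>0. \<exists>d>0. \<forall>(n::nat) (a::nat \<Rightarrow> real) (b::nat \<Rightarrow> real).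
        (\<forall>i<n. s \<le> a i \<and> a i < b i \<and> b i \<le> t) \<longrightarrow>
        disjoint_family_on (\<lambda>i. {a i<..<b i}) {..<n} \<longrightarrow>
        (\<Sum>i<n. b i - a i) < d \<longrightarrow>
        (\<Sum>i<n. dist (\<gamma> (a i)) (\<gamma> (b i))) < e)"

text \<open>The chain rule at almost every \<open>t\<close> includes the existence of both derivatives there.
  Curves on \<open>[0,1]\<close> are functions on the reals of which only the restriction to \<open>{0..1}\<close> matters.
  The local Lipschitz continuity of \<open>f\<close>, required for this notion, is a separate
  hypothesis wherever it is used.\<close>

definition conservative_field ::
    "('a::euclidean_space \<Rightarrow> 'a set) \<Rightarrow> ('a \<Rightarrow> real) \<Rightarrow> bool" where
  "conservative_field D f \<longleftrightarrow>
     closed {(x, v). v \<in> D x} \<and>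
     (\<forall>x. D x \<noteq> {} \<and> compact (D x)) \<and>
     (\<forall>\<gamma>. abs_continuous_curve 0 1 \<gamma> \<longrightarrow>
        (AE t in lborel. t \<in> {0..1} \<longrightarrow>
           (\<exists>\<gamma>'. (\<gamma> has_vector_derivative \<gamma>') (at t within {0..1}) \<and>
              (\<forall>v\<in>D (\<gamma> t).
                 ((\<lambda>s. f (\<gamma> s)) has_real_derivative (v \<bullet> \<gamma>')) (at t within {0..1})))))"

definition convex_subdifferential :: "('a::real_inner \<Rightarrow> ereal) \<Rightarrow> 'a \<Rightarrow> 'a set" where
  "convex_subdifferential h x =
     {v. \<bar>h x\<bar> \<noteq> \<infinity> \<and> (\<forall>y. h y \<ge> h x + ereal (v \<bullet> (y - x)))}"

definition total_objective ::
    "nat \<Rightarrow> (nat \<Rightarrow> 'a \<Rightarrow> real) \<Rightarrow> ('a \<Rightarrow> ereal) \<Rightarrow> 'a \<Rightarrow> ereal" where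
  "total_objective N f g x = ereal (\<Sum>i=1..N. f i x) + g x"

text \<open>The sums below are Minkowski sums of sets, from \<open>HOL-Library.Set_Algebras\<close>.\<close>

definition total_field ::
    "nat \<Rightarrow> (nat \<Rightarrow> 'a::euclidean_space \<Rightarrow> 'a set) \<Rightarrow> ('a \<Rightarrow> ereal) \<Rightarrow> 'a \<Rightarrow> 'a set" where
  "total_field N D g x = (\<Sum>i=1..N. D i x) + convex_subdifferential g x"

text \<open>The set of all minimizers; it is a singleton when \<open>h\<close> is proper, convex and
  lower semicontinuous.\<close>

definition prox :: "('a::euclidean_space \<Rightarrow> ereal) \<Rightarrow> 'a \<Rightarrow> 'a set" where
  "prox h x = {y. is_arg_min (\<lambda>z. h z + ereal ((norm (z - x))\<^sup>2 / 2)) (\<lambda>_. True) y}"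

definition prr_sequence ::
    "nat \<Rightarrow> (nat \<Rightarrow> 'a::euclidean_space \<Rightarrow> real) \<Rightarrow> (nat \<Rightarrow> 'a \<Rightarrow> 'a set) \<Rightarrow> ('a \<Rightarrow> ereal)
      \<Rightarrow> (nat \<Rightarrow> real) \<Rightarrow> (nat \<Rightarrow> 'a) \<Rightarrow> bool" where
  "prr_sequence N f D g \<alpha> x \<longleftrightarrow>
     (\<forall>k. \<alpha> k > 0) \<and> x 0 \<in> effective_domain (total_objective N f g) \<and>
     (\<exists>(\<sigma> :: nat \<Rightarrow> nat \<Rightarrow> nat) (y :: nat \<Rightarrow> nat \<Rightarrow> 'a). \<forall>k.
        \<sigma> k permutes {1..N} \<and>
        y k 0 = x k \<and>
        (\<forall>i\<in>{1..N}. y k i \<in> (\<lambda>v. y k (i - 1) - \<alpha> k *\<^sub>R v) ` D (\<sigma> k i) (y k (i - 1))) \<and>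
        x (Suc k) \<in> prox (\<lambda>z. ereal (\<alpha> k) * g z) (y k N))"

text \<open>Unlike \<open>infdist\<close>, the distance to the empty set is \<open>\<infinity>\<close>.\<close>

definition dist_to_set :: "'a::metric_space \<Rightarrow> 'a set \<Rightarrow> ereal" where
  "dist_to_set x S = (INF y\<in>S. ereal (dist x y))"

definition near_approx_stationary ::
    "real \<Rightarrow> real \<Rightarrow> ('a::euclidean_space \<Rightarrow> 'a set) \<Rightarrow> 'a \<Rightarrow> bool" where
  "near_approx_stationary \<epsilon> \<delta> D x \<longleftrightarrow> dist_to_set 0 (\<Union> (D ` cball x \<epsilon>)) \<le> ereal \<delta>"

end

theory Submission
  imports Defs "HOL-Complex_Analysis.Great_Picard"
begin

text \<open>
  By contradiction: suppose that for step sizes bounded by \<open>\<beta>\<^sub>n \<rightarrow> 0\<close> there are PRR sequences without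
  near stationary iterates. Local Lipschitz continuity of \<open>g\<close> on its domain bounds the proximal steps, so
  that on a bounded region the velocity of each step is a bounded element of a small enlargement of
  \<open>- D\<^sub>\<Phi>\<close>. The interpolated iterates, stopped at a time \<open>\<tau>\<close> or on leaving a ball of radius \<open>\<rho>\<close>, are
  equi-Lipschitz and converge along a subsequence to a curve with \<open>\<gamma>' \<in> - D\<^sub>\<Phi>(\<gamma>)\<close>, because the values
  of \<open>D\<^sub>\<Phi>\<close> are closed and convex and difference quotients are convex combinations of velocities.
  On the limit curve the elements of \<open>D\<^sub>\<Phi>\<close> have norm at least \<open>\<delta>\<close>, and the chain rule gives
  \<open>(\<Phi> \<circ> \<gamma>)' = - \<parallel>\<gamma>'\<parallel>\<^sup>2\<close>. This is at most \<open>- \<delta>\<^sup>2\<close> and also at most \<open>- \<delta> \<parallel>\<gamma>'\<parallel>\<close>, so a total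
  decrease of at most \<open>\<Delta>\<close> bounds the duration by \<open>\<Delta>/\<delta>\<^sup>2\<close> and the displacement by \<open>\<Delta>/\<delta>\<close>,
  which contradicts the choice of \<open>\<tau>\<close> and \<open>\<rho>\<close>.
\<close>

section \<open>Lipschitz functions and closed graphs\<close>

text \<open>The exceptional null set is covered by an open set \<open>U\<close> of measure at most \<open>c\<close>, on which \<open>h\<close>
  increases by at most \<open>L * c\<close>; elsewhere \<open>h\<close> increases locally with slope at most \<open>c\<close>.\<close>

lemma lipschitz_nonincreasing:
  fixes h :: "real \<Rightarrow> real"
  assumes lip: "L-lipschitz_on {0..1} h"
    and der: "AE t in lborel. t \<in> {0<..<1} \<longrightarrow> (\<exists>d\<le>0. (h has_real_derivative d) (at t))"
  shows "h 1 \<le> h 0"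
proof (rule field_le_epsilon)
  fix e :: real assume "e > 0"
  have L0: "L \<ge> 0" using lip by (rule lipschitz_on_nonneg)
  \<comment> \<open>\<open>c\<close> serves both as the slope allowed off the open set and as the
    bound for its measure; the total error is then \<open>c + L * c = e\<close>.\<close>
  define c where "c = e / (L + 1)"
  have c0: "c > 0" using \<open>e > 0\<close> L0 by (simp add: c_def)
  obtain Z where Z: "Z \<in> null_sets lborel"
    "{t. \<not> (t \<in> {0<..<1} \<longrightarrow> (\<exists>d\<le>0. (h has_real_derivative d) (at t)))} \<subseteq> Z"
    using der unfolding eventually_ae_filter by auto
  \<comment> \<open>The endpoints join the exceptional set because derivatives are assumed in the
    open interval only.\<close>
  define Y where "Y = Z \<union> {0,1}"
  have Y: "Y \<in> null_sets lborel"
    unfolding Y_def using Z(1) by (intro null_sets.Un) (auto intro: finite_imp_null_set_lborel)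
  have Ye: "emeasure lebesgue Y = 0"
    using null_setsD1[OF null_sets_completionI[OF Y]] .
  have "Y \<in> sets lebesgue"
    using Y by auto
  then obtain U where U: "open U" "Y \<subseteq> U" "(U - Y) \<in> lmeasurable" "emeasure lebesgue (U - Y) < ennreal c"
    using sets_lebesgue_outer_open[OF _ c0] by metis
  have "U \<in> sets lebesgue" using U(1) by auto
  have "emeasure lebesgue U = emeasure lebesgue (U - Y)"
    using emeasure_Diff_null_set[OF null_sets_completionI[OF Y] \<open>U \<in> sets lebesgue\<close>] by (rule sym)
  then have Uc: "emeasure lebesgue U < ennreal c" using U(4) by simp
  then have Ul: "U \<in> lmeasurable"
    using \<open>U \<in> sets lebesgue\<close> by (auto simp: fmeasurable_def intro: less_trans)
  have mU: "measure lebesgue U \<le> c"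
    using Uc c0 emeasure_eq_measure2[OF Ul] by (simp add: ennreal_less_iff)
  have ml: "U \<inter> S \<in> lmeasurable" if "S \<in> sets lebesgue" for S
    using Ul that by (rule fmeasurable_Int_fmeasurable)
  \<comment> \<open>The bound adds up over adjacent intervals because half-open pieces are disjoint,
    as \<open>Bolzano\<close> requires. The two premises discard intervals that stick out of [0,1],
    which also occur in its local condition.\<close>
  define P where "P = (\<lambda>a b. 0 \<le> a \<longrightarrow> b \<le> 1 \<longrightarrow>
    h b - h a \<le> c * (b - a) + L * measure lebesgue (U \<inter> {a<..b}))"
  have "P 0 1"
  proof (rule Bolzano)
    show "(0::real) \<le> 1" by simp
  next
    fix a b c' assume 2: "P a b" "P b c'" "a \<le> b" "b \<le> c'"
    have "measure lebesgue (U \<inter> {a<..c'}) = measure lebesgue ((U \<inter> {a<..b}) \<union> (U \<inter> {b<..c'}))"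
      using 2 by (intro arg_cong[where f="measure lebesgue"]) auto
    also have "\<dots> = measure lebesgue (U \<inter> {a<..b}) + measure lebesgue (U \<inter> {b<..c'})"
      by (intro measure_Un_AE AE_I2 ml) auto
    finally show "P a c'" using 2 by (auto simp: P_def algebra_simps)
  next
    fix x :: real assume 3: "0 \<le> x" "x \<le> 1"
    show "\<exists>d>0. \<forall>a b. a \<le> x \<and> x \<le> b \<and> b - a < d \<longrightarrow> P a b"
    proof (cases "x \<in> Y")
      case True
      then obtain d where d: "d > 0" "ball x d \<subseteq> U" using U(1,2) by (meson openE subsetD)
      show ?thesis
      proof (intro exI[of _ d] conjI allI impI)
        fix a b assume ab: "a \<le> x \<and> x \<le> b \<and> b - a < d"
        have "U \<inter> {a<..b} = {a<..b}"
          using ab d(2) by (auto simp: dist_real_def subset_iff)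
        then have "measure lebesgue (U \<inter> {a<..b}) = b - a" using ab by simp
        moreover have "h b - h a \<le> L * (b - a)" if "0 \<le> a" "b \<le> 1"
          using lipschitz_onD[OF lip, of b a] that ab by (auto simp: dist_real_def)
        ultimately show "P a b" using c0 ab by (auto simp: P_def intro: order_trans)
      qed (use d in auto)
    next
      case False
      then have "x \<in> {0<..<1}" using 3 by (auto simp: Y_def less_le)
      moreover have "x \<notin> Z" using False by (auto simp: Y_def)
      ultimately obtain d where d: "d \<le> 0" "(h has_real_derivative d) (at x)"
        using Z(2) by blast
      have "(h has_derivative (\<lambda>y. d * y)) (at x)"
        using d(2) by (simp add: has_field_derivative_def)
      then obtain r where r: "r > 0" "\<And>y. norm (y - x) < r \<Longrightarrow> norm (h y - h x - d * (y - x)) \<le> c * norm (y - x)"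
        unfolding has_derivative_at_alt using c0 by blast
      show ?thesis
      proof (intro exI[of _ r] conjI allI impI)
        fix a b assume ab: "a \<le> x \<and> x \<le> b \<and> b - a < r"
        have 1: "\<bar>h b - h x - d * (b - x)\<bar> \<le> c * (b - x)"
          using r(2)[of b] ab by auto
        have 2: "\<bar>h a - h x - d * (a - x)\<bar> \<le> c * (x - a)"
          using r(2)[of a] ab by auto
        have "d * (b - a) \<le> 0" using d(1) ab by (simp add: mult_nonpos_nonneg)
        then have "h b - h a \<le> c * (b - a)"
          using 1 2 by (simp add: algebra_simps abs_le_iff)
        moreover have "0 \<le> L * measure lebesgue (U \<inter> {a<..b})" using L0 by simp
        ultimately show "P a b" by (auto simp: P_def)
      qed (use r in auto)
    qed
  qed
  then have "h 1 - h 0 \<le> c + L * measure lebesgue (U \<inter> {0<..1})" by (simp add: P_def)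
  also have "measure lebesgue (U \<inter> {0<..1}) \<le> c"
  proof (rule order_trans[OF _ mU])
    show "measure lebesgue (U \<inter> {0<..1}) \<le> measure lebesgue U"
      using Ul ml[of "{0<..1}"] by (intro measure_mono_fmeasurable) auto
  qed
  finally have "h 1 - h 0 \<le> c + L * c" using L0 by (simp add: mult_left_mono)
  also have "c + L * c = c * (L + 1)" by (simp add: algebra_simps)
  also have "\<dots> = e" using L0 by (simp add: c_def)
  finally show "h 1 \<le> h 0 + e" by simp
qed

lemma lipschitz_imp_abs_continuous_curve:
  assumes "L-lipschitz_on {s..t} \<gamma>"
  shows "abs_continuous_curve s t \<gamma>"
  unfolding abs_continuous_curve_def
proof (intro allI impI)
  fix e :: real assume "e > 0"
  have L0: "L \<ge> 0" using assms by (rule lipschitz_on_nonneg)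
  show "\<exists>d>0. \<forall>(n::nat) a b. (\<forall>i<n. s \<le> a i \<and> a i < b i \<and> b i \<le> t) \<longrightarrow>
        disjoint_family_on (\<lambda>i. {a i<..<b i}) {..<n} \<longrightarrow> (\<Sum>i<n. b i - a i) < d \<longrightarrow>
        (\<Sum>i<n. dist (\<gamma> (a i)) (\<gamma> (b i))) < e"
  proof (intro exI[of _ "e / (L + 1)"] conjI allI impI)
    fix n :: nat and a b :: "nat \<Rightarrow> real"
    assume ab: "\<forall>i<n. s \<le> a i \<and> a i < b i \<and> b i \<le> t" and sm: "(\<Sum>i<n. b i - a i) < e / (L + 1)"
    have "(\<Sum>i<n. dist (\<gamma> (a i)) (\<gamma> (b i))) \<le> (\<Sum>i<n. L * (b i - a i))"
    proof (rule sum_mono)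
      fix i assume "i \<in> {..<n}"
      then show "dist (\<gamma> (a i)) (\<gamma> (b i)) \<le> L * (b i - a i)"
        using lipschitz_onD[OF assms, of "a i" "b i"] ab[rule_format, of i] by (simp add: dist_real_def)
    qed
    also have "\<dots> = L * (\<Sum>i<n. b i - a i)" by (simp add: sum_distrib_left)
    also have "\<dots> \<le> L * (e / (L + 1))" using sm L0 by (intro mult_left_mono) auto
    also have "\<dots> < e" using \<open>e > 0\<close> L0 by (simp add: field_simps)
    finally show "(\<Sum>i<n. dist (\<gamma> (a i)) (\<gamma> (b i))) < e" .
  qed (use \<open>e > 0\<close> L0 in auto)
qed

lemma locally_lipschitz_on_subset:
  "locally_lipschitz_on S h \<Longrightarrow> T \<subseteq> S \<Longrightarrow> locally_lipschitz_on T h"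
  unfolding locally_lipschitz_on_def
  by (blast intro: lipschitz_on_subset[OF _ Int_mono[OF order_refl]])

lemma locally_lipschitz_on_imp_continuous_on:
  assumes "locally_lipschitz_on S h"
  shows "continuous_on S h"
  unfolding continuous_on_eq_continuous_within
proof
  fix x assume "x \<in> S"
  then obtain r L where r: "r > 0" and L: "L-lipschitz_on (cball x r \<inter> S) h"
    using assms by (auto simp: locally_lipschitz_on_def)
  have "continuous (at x within cball x r \<inter> S) h"
    using lipschitz_on_continuous_within[OF L] \<open>x \<in> S\<close> r by simp
  then have "(h \<longlongrightarrow> h x) (at x within cball x r \<inter> S)"
    by (simp add: continuous_within)
  then show "continuous (at x within S) h"
    unfolding continuous_within
  proof (rule Lim_transform_within_set)
    show "\<forall>\<^sub>F y in at x. (y \<in> cball x r \<inter> S) = (y \<in> S)"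
      using r eventually_at_ball[of r x UNIV] by (auto elim!: eventually_mono)
  qed
qed

lemma locally_lipschitz_on_compact:
  fixes h :: "'a::metric_space \<Rightarrow> 'b::metric_space"
  assumes "locally_lipschitz_on S h" "compact S"
  obtains L where "L-lipschitz_on S h"
proof -
  \<comment> \<open>The compactness theorem concerns time-dependent maps, so \<open>h\<close> is
    regarded as such a map over the single time 0.\<close>
  have *: "local_lipschitz {0::real} S (\<lambda>_. h)"
    using assms(1) unfolding local_lipschitz_def locally_lipschitz_on_def by fastforce
  then obtain L where "\<And>t. t \<in> {0::real} \<Longrightarrow> L-lipschitz_on S h"
    using local_lipschitz_compact_implies_lipschitz[OF * assms(2)] by auto
  then show ?thesis using that by simp
qed

text \<open>A sequence of counterexamples over base points tending to \<open>x\<close> has values in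
  a fixed ball, hence a convergent subsequence; by closedness its limit is a value over
  \<open>x\<close>, a contradiction. The bound \<open>B\<close> makes the argument applicable to
  maps with unbounded values such as \<partial>g.\<close>

lemma closed_graph_upper_semicontinuous:
  fixes G :: "('a::metric_space \<times> 'b::heine_borel) set"
  assumes "closed G" and "e > 0"
  shows "\<exists>\<eta>>0. \<forall>y v. dist y x \<le> \<eta> \<longrightarrow> (y, v) \<in> G \<longrightarrow> dist c v \<le> B \<longrightarrow> (\<exists>v'. (x, v') \<in> G \<and> dist v v' \<le> e)"
proof (rule ccontr)
  assume neg: "\<not> ?thesis"
  have "\<exists>y v. dist y x \<le> 1 / real (Suc n) \<and> (y, v) \<in> G \<and> dist c v \<le> B \<and> (\<forall>v'. (x, v') \<in> G \<longrightarrow> dist v v' > e)" for n :: nat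
  proof -
    have "(0::real) < 1 / real (Suc n)" by simp
    with neg show ?thesis by (meson not_le)
  qed
  then obtain y v where yv: "\<And>n. dist (y n) x \<le> 1 / real (Suc n)" "\<And>n. (y n, v n) \<in> G"
     "\<And>n. dist c (v n) \<le> B" "\<And>n v'. (x, v') \<in> G \<Longrightarrow> dist (v n) v' > e" by metis
  have "bounded (range v)" using yv(3) by (auto simp: bounded_def)
  then obtain l r where l: "strict_mono r" "(v \<circ> r) \<longlonglongrightarrow> l"
    using bounded_imp_convergent_subsequence by blast
  have "(\<lambda>n. dist (y n) x) \<longlonglongrightarrow> 0"
  proof (rule tendsto_sandwich[OF _ _ tendsto_const])
    show "(\<lambda>n. 1 / real (Suc n)) \<longlonglongrightarrow> 0"
      using LIMSEQ_inverse_real_of_nat by (simp add: inverse_eq_divide)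
  qed (use yv(1) in auto)
  then have "y \<longlonglongrightarrow> x" using tendsto_dist_iff by blast
  then have "(y \<circ> r) \<longlonglongrightarrow> x" using l(1) by (rule LIMSEQ_subseq_LIMSEQ)
  then have "(\<lambda>n. (y (r n), v (r n))) \<longlonglongrightarrow> (x, l)" using l(2) by (intro tendsto_Pair) (auto simp: o_def)
  then have "(x, l) \<in> G" using yv(2) 
    using closed_sequentially[OF assms(1), of "\<lambda>n. (y (r n), v (r n))"] by blast
  moreover from l(2) \<open>e > 0\<close> have "\<forall>\<^sub>F n in sequentially. dist ((v \<circ> r) n) l < e" by (rule tendstoD)
  then obtain n where "dist (v (r n)) l < e" by (auto simp: eventually_sequentially)
  ultimately show False using yv(4)[of l "r n"] by simp
qed

section \<open>Structure of the total field\<close>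

lemma bounded_locally_bounded_map_image:
  fixes D :: "'a::heine_borel \<Rightarrow> 'b::metric_space set"
  assumes D: "locally_bounded_map D" and S: "compact S"
  shows "bounded (\<Union>x\<in>S. D x)"
proof -
  from D obtain U where U: "\<And>x. open (U x) \<and> x \<in> U x \<and> bounded (\<Union> (D ` U x))"
    unfolding locally_bounded_map_def by metis
  obtain C where C: "C \<subseteq> S" "finite C" "S \<subseteq> (\<Union>x\<in>C. U x)"
    using compactE_image[OF S, of S U] U by blast
  have "bounded (\<Union>x\<in>C. \<Union> (D ` U x))"
    using C(2) U by (intro bounded_UN) auto
  then show ?thesis
    by (rule bounded_subset) (use C(3) in blast)
qed

lemma bounded_locally_bounded_map_near:
  fixes D :: "'a::heine_borel \<Rightarrow> 'b::real_normed_vector set"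
  assumes "locally_bounded_map D"
  obtains M where "\<And>z v. dist z x \<le> r \<Longrightarrow> v \<in> D z \<Longrightarrow> norm v \<le> M"
proof -
  have "bounded (\<Union>z\<in>cball x r. D z)"
    by (rule bounded_locally_bounded_map_image[OF assms compact_cball])
  then obtain M where "\<forall>v\<in>(\<Union>z\<in>cball x r. D z). norm v \<le> M"
    unfolding bounded_iff by blast
  then show ?thesis by (intro that[of M]) (auto simp: dist_commute)
qed

text \<open>Lower boundedness of \<Phi> is added only in the final argument, where it caps the total
  decrease.\<close>

locale prr_setting =
  fixes N :: nat
    and f :: "nat \<Rightarrow> 'a::euclidean_space \<Rightarrow> real"
    and D :: "nat \<Rightarrow> 'a \<Rightarrow> 'a set"
    and g :: "'a \<Rightarrow> ereal"
  assumes N_ge_1: "N \<ge> 1"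
    and f_lipschitz: "\<And>i. i \<in> {1..N} \<Longrightarrow> locally_lipschitz_on UNIV (f i)"
    and D_conservative: "\<And>i. i \<in> {1..N} \<Longrightarrow> conservative_field (D i) (f i)"
    and D_bounded: "\<And>i. i \<in> {1..N} \<Longrightarrow> locally_bounded_map (D i)"
    and D_convex: "\<And>i x. i \<in> {1..N} \<Longrightarrow> convex (D i x)"
    and g_proper: "proper_ereal g"
    and g_convex: "convex_ereal g"
    and g_dom_closed: "closed (effective_domain g)"
    and g_lipschitz: "locally_lipschitz_on (effective_domain g) (\<lambda>x. real_of_ereal (g x))"
begin

section \<open>The convex function on its domain, its subgradients and proximal points\<close>

definition G :: "'a \<Rightarrow> real" where "G x = real_of_ereal (g x)"

text \<open>Properness excludes -\<infinity> and membership in the domain excludes \<infinity>.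
  Outside the domain \<open>real_of_ereal\<close> returns 0, so \<open>G\<close> represents
  \<open>g\<close> on the domain only.\<close>

lemma g_eq_G: "x \<in> effective_domain g \<Longrightarrow> g x = ereal (G x)"
  using g_proper by (cases "g x") (auto simp: G_def effective_domain_def proper_ereal_def)

lemma G_locally_lipschitz: "locally_lipschitz_on (effective_domain g) G"
  using g_lipschitz by (simp add: G_def[abs_def])

lemma G_continuous: "continuous_on (effective_domain g) G"
  by (rule locally_lipschitz_on_imp_continuous_on[OF G_locally_lipschitz])

lemma G_convex:
  assumes "x \<in> effective_domain g" "y \<in> effective_domain g" "0 \<le> t" "t \<le> 1"
  shows "x + t *\<^sub>R (y - x) \<in> effective_domain g"
    and "G (x + t *\<^sub>R (y - x)) \<le> G x + t * (G y - G x)"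
proof -
  have "(x, G x) \<in> {(x, r::real). g x \<le> ereal r}" "(y, G y) \<in> {(x, r::real). g x \<le> ereal r}"
    using assms g_eq_G by auto
  then have "(1 - t) *\<^sub>R (x, G x) + t *\<^sub>R (y, G y) \<in> {(x, r::real). g x \<le> ereal r}"
    using assms(3,4) by (rule convexD_alt[OF g_convex[unfolded convex_ereal_def]])
  moreover have "(1 - t) *\<^sub>R (x, G x) + t *\<^sub>R (y, G y) = (x + t *\<^sub>R (y - x), G x + t * (G y - G x))"
    by (simp add: algebra_simps)
  ultimately have *: "g (x + t *\<^sub>R (y - x)) \<le> ereal (G x + t * (G y - G x))" by simp
  then show 1: "x + t *\<^sub>R (y - x) \<in> effective_domain g"
    by (auto simp: effective_domain_def intro: le_less_trans)
  show "G (x + t *\<^sub>R (y - x)) \<le> G x + t * (G y - G x)"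
    using * g_eq_G[OF 1] by simp
qed

text \<open>Test points outside the domain impose no condition because \<open>g\<close> is
  \<infinity> there; subgradients can therefore be handled with real inequalities.\<close>

lemma subdifferential_iff:
  "v \<in> convex_subdifferential g x \<longleftrightarrow>
    x \<in> effective_domain g \<and> (\<forall>y\<in>effective_domain g. G x + v \<bullet> (y - x) \<le> G y)"
proof (cases "x \<in> effective_domain g")
  case True
  have "(\<forall>y. g x + ereal (v \<bullet> (y - x)) \<le> g y) \<longleftrightarrow> (\<forall>y\<in>effective_domain g. G x + v \<bullet> (y - x) \<le> G y)"
  proof (intro iffI allI ballI)
    fix y assume "\<forall>y. g x + ereal (v \<bullet> (y - x)) \<le> g y" "y \<in> effective_domain g"
    then have "g x + ereal (v \<bullet> (y - x)) \<le> g y" by blast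
    then show "G x + v \<bullet> (y - x) \<le> G y"
      using g_eq_G[OF True] g_eq_G[OF \<open>y \<in> effective_domain g\<close>] by simp
  next
    fix y assume *: "\<forall>y\<in>effective_domain g. G x + v \<bullet> (y - x) \<le> G y"
    show "g x + ereal (v \<bullet> (y - x)) \<le> g y"
    proof (cases "y \<in> effective_domain g")
      case True
      then show ?thesis using * g_eq_G[OF True] g_eq_G[OF \<open>x \<in> effective_domain g\<close>] by simp
    qed (auto simp: effective_domain_def)
  qed
  then show ?thesis
    using True g_eq_G[OF True] by (auto simp: convex_subdifferential_def)
qed (auto simp: convex_subdifferential_def effective_domain_def)

text \<open>Closedness of the domain keeps the limit point inside it, and continuity of
  \<open>G\<close> on the domain lets the subgradient inequality pass to the limit.\<close>

lemma closed_subdifferential_graph: "closed {(x, v). v \<in> convex_subdifferential g x}"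
  unfolding closed_sequential_limits
proof (intro allI impI, elim conjE)
  fix p and l :: "'a \<times> 'a"
  assume p: "\<forall>n. p n \<in> {(x, v). v \<in> convex_subdifferential g x}" and l: "p \<longlonglongrightarrow> l"
  have x: "(\<lambda>n. fst (p n)) \<longlonglongrightarrow> fst l" and v: "(\<lambda>n. snd (p n)) \<longlonglongrightarrow> snd l"
    using l by (auto intro: tendsto_fst tendsto_snd)
  have pd: "fst (p n) \<in> effective_domain g" for n
    using p[rule_format, of n] by (auto simp: subdifferential_iff split: prod.splits)
  then have ld: "fst l \<in> effective_domain g"
    using closed_sequentially[OF g_dom_closed _ x] by blast
  have Gx: "(\<lambda>n. G (fst (p n))) \<longlonglongrightarrow> G (fst l)"
    using continuous_on_tendsto_compose[OF G_continuous x ld] pd by simp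
  have "G (fst l) + snd l \<bullet> (y - fst l) \<le> G y" if y: "y \<in> effective_domain g" for y
  proof (rule LIMSEQ_le_const2)
    show "(\<lambda>n. G (fst (p n)) + snd (p n) \<bullet> (y - fst (p n))) \<longlonglongrightarrow> G (fst l) + snd l \<bullet> (y - fst l)"
      by (intro tendsto_intros Gx x v)
    show "\<exists>N. \<forall>n\<ge>N. G (fst (p n)) + snd (p n) \<bullet> (y - fst (p n)) \<le> G y"
      using p y by (fastforce simp: subdifferential_iff split: prod.splits)
  qed
  then show "l \<in> {(x, v). v \<in> convex_subdifferential g x}"
    using ld by (auto simp: subdifferential_iff split: prod.splits)
qed

lemma closed_subdifferential: "closed (convex_subdifferential g x)"
proof -
  have "convex_subdifferential g x = (\<lambda>v. (x, v)) -` {(x, v). v \<in> convex_subdifferential g x}" by auto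
  also have "closed \<dots>"
    by (rule closed_vimage[OF closed_subdifferential_graph]) (intro continuous_intros)
  finally show ?thesis .
qed

lemma convex_subdifferential_convex: "convex (convex_subdifferential g x)"
proof (rule convexI)
  fix v w and s t :: real
  assume v: "v \<in> convex_subdifferential g x" and w: "w \<in> convex_subdifferential g x"
    and st: "0 \<le> s" "0 \<le> t" "s + t = 1"
  have "G x + (s *\<^sub>R v + t *\<^sub>R w) \<bullet> (y - x) \<le> G y" if "y \<in> effective_domain g" for y
  proof -
    have "v \<bullet> (y - x) \<le> G y - G x" "w \<bullet> (y - x) \<le> G y - G x"
      using v w that by (fastforce simp: subdifferential_iff)+
    then have "s * (v \<bullet> (y - x)) \<le> s * (G y - G x)" "t * (w \<bullet> (y - x)) \<le> t * (G y - G x)"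
      using st by (simp_all add: mult_left_mono)
    then have "(s *\<^sub>R v + t *\<^sub>R w) \<bullet> (y - x) \<le> (s + t) * (G y - G x)"
      by (simp add: inner_add_left distrib_right)
    then show ?thesis using st by simp
  qed
  then show "s *\<^sub>R v + t *\<^sub>R w \<in> convex_subdifferential g x"
    using v by (auto simp: subdifferential_iff)
qed

text \<open>This is the optimality condition of the proximal step. The minimizer \<open>z\<close> is
  compared with the point at parameter \<open>t\<close> on the segment from \<open>z\<close> to
  \<open>q\<close>: by convexity \<open>G\<close> changes at most linearly in \<open>t\<close>, and
  the square contributes a term of order \<open>t^2\<close> that disappears after division by
  \<open>t\<close>.\<close>

lemma prox_subgradient:
  assumes a: "\<alpha> > 0" and z: "z \<in> prox (\<lambda>z. ereal \<alpha> * g z) y"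
  shows "(1 / \<alpha>) *\<^sub>R (y - z) \<in> convex_subdifferential g z"
proof -
  have min: "ereal \<alpha> * g z + ereal ((norm (z - y))\<^sup>2 / 2) \<le> ereal \<alpha> * g q + ereal ((norm (q - y))\<^sup>2 / 2)" for q
    using z by (simp add: prox_def is_arg_min_linorder)
  obtain q0 where q0: "q0 \<in> effective_domain g"
    using g_proper by (auto simp: proper_ereal_def)
  have zd: "z \<in> effective_domain g"
  proof (rule ccontr)
    assume "z \<notin> effective_domain g"
    then have "g z = \<infinity>" by (simp add: effective_domain_def)
    then show False using min[of q0] g_eq_G[OF q0] a by simp
  qed
  have minG: "\<alpha> * G z + (norm (z - y))\<^sup>2 / 2 \<le> \<alpha> * G q + (norm (q - y))\<^sup>2 / 2" if "q \<in> effective_domain g" for q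
    using min[of q] g_eq_G[OF zd] g_eq_G[OF that] by simp
  have "(y - z) \<bullet> (q - z) \<le> \<alpha> * (G q - G z)" if q: "q \<in> effective_domain g" for q
  proof (rule field_le_epsilon)
    fix e :: real assume "e > 0"
    define S where "S = (norm (q - z))\<^sup>2 / 2"
    \<comment> \<open>With this choice the remainder \<open>t * S\<close> is at most
      \<open>e\<close>; the minimum with 1 keeps the point on the segment, and the denominator is
      positive even when \<open>S = 0\<close>.\<close>
    define t where "t = min 1 (e / (S + 1))"
    have S: "S \<ge> 0" by (simp add: S_def)
    have t: "0 < t" "t \<le> 1" using \<open>e > 0\<close> S by (auto simp: t_def)
    have "t * S \<le> e / (S + 1) * S" using S by (intro mult_right_mono) (auto simp: t_def)
    also have "\<dots> \<le> e" using S \<open>e > 0\<close> by (simp add: field_simps)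
    finally have tS: "t * S \<le> e" .
    have "\<alpha> * G z + (norm (z - y))\<^sup>2 / 2
        \<le> \<alpha> * G (z + t *\<^sub>R (q - z)) + (norm (z + t *\<^sub>R (q - z) - y))\<^sup>2 / 2"
      by (rule minG[OF G_convex(1)[OF zd q]]) (use t in auto)
    also have "\<dots> \<le> \<alpha> * (G z + t * (G q - G z)) + (norm (z + t *\<^sub>R (q - z) - y))\<^sup>2 / 2"
      using G_convex(2)[OF zd q, of t] t a by (intro add_right_mono mult_left_mono) auto
    also have "z + t *\<^sub>R (q - z) - y = (z - y) + t *\<^sub>R (q - z)" by simp
    also have "(norm ((z - y) + t *\<^sub>R (q - z)))\<^sup>2 / 2
        = (norm (z - y))\<^sup>2 / 2 + t * ((z - y) \<bullet> (q - z)) + t * (t * S)"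
      unfolding S_def power2_norm_eq_inner inner_add_left inner_add_right inner_scaleR_left inner_scaleR_right
      by (simp add: inner_commute[of "q - z" "z - y"] field_simps)
    finally have "0 \<le> t * (\<alpha> * (G q - G z) + (z - y) \<bullet> (q - z) + t * S)"
      by (simp add: algebra_simps)
    then have "0 \<le> \<alpha> * (G q - G z) + (z - y) \<bullet> (q - z) + t * S"
      using t by (simp add: zero_le_mult_iff)
    moreover have "(y - z) \<bullet> (q - z) = - ((z - y) \<bullet> (q - z))" by (simp add: inner_diff_left)
    ultimately show "(y - z) \<bullet> (q - z) \<le> \<alpha> * (G q - G z) + e" using tS by linarith
  qed
  then have "((1 / \<alpha>) *\<^sub>R (y - z)) \<bullet> (q - z) \<le> G q - G z" if "q \<in> effective_domain g" for q
    using that a unfolding inner_scaleR_left by (simp add: field_simps)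
  then show ?thesis
    using zd unfolding subdifferential_iff by (smt (verit))
qed

text \<open>The bound on \<open>w\<close> is needed because \<open>\<partial>g\<close> is unbounded on the boundary of the domain.\<close>

definition enlarged_field :: "real \<Rightarrow> real \<Rightarrow> 'a \<Rightarrow> 'a set" where
  "enlarged_field B r x = {(\<Sum>i=1..N. v i) + w |v w.
     (\<forall>i\<in>{1..N}. \<exists>z. dist z x \<le> r \<and> v i \<in> D i z) \<and>
     (\<exists>z. dist z x \<le> r \<and> w \<in> convex_subdifferential g z) \<and> norm w \<le> B}"

lemma enlarged_fieldI:
  assumes "\<And>i. i \<in> {1..N} \<Longrightarrow> \<exists>z. dist z x \<le> r \<and> v i \<in> D i z"
    and "\<exists>z. dist z x \<le> r \<and> w \<in> convex_subdifferential g z" and "norm w \<le> B"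
  shows "(\<Sum>i=1..N. v i) + w \<in> enlarged_field B r x"
  unfolding enlarged_field_def mem_Collect_eq
  by (rule exI[of _ v], rule exI[of _ w], intro conjI ballI refl) (fact assms)+

lemma enlarged_field_mono:
  assumes "r + dist x y \<le> s"
  shows "enlarged_field B r x \<subseteq> enlarged_field B s y"
proof -
  have "dist z y \<le> s" if "dist z x \<le> r" for z
    using assms that dist_triangle[of z y x] by linarith
  then show ?thesis unfolding enlarged_field_def by blast
qed

section \<open>Convexity, closedness and upper semicontinuity of the total field\<close>

lemma total_field_iff:
  "u \<in> total_field N D g x \<longleftrightarrow>
    (\<exists>v w. (\<forall>i\<in>{1..N}. v i \<in> D i x) \<and> w \<in> convex_subdifferential g x \<and> u = (\<Sum>i=1..N. v i) + w)"
  unfolding total_field_def set_sum_alt[OF finite_atLeastAtMost] set_plus_def by auto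

lemma convex_total_field: "convex (total_field N D g x)"
  unfolding total_field_def
  by (intro convex_set_plus convex_set_sum D_convex convex_subdifferential_convex)

lemma D_compact: "i \<in> {1..N} \<Longrightarrow> compact (D i x)"
  using D_conservative by (auto simp: conservative_field_def)

text \<open>A sum of two closed sets may fail to be closed, but here the sum of the
  \<open>D i x\<close> is compact, and a compact set plus a closed set is closed.\<close>

lemma closed_total_field: "closed (total_field N D g x)"
proof -
  have "compact (\<Sum>i\<in>A. D i x)" if "finite A" "A \<subseteq> {1..N}" for A
    using that
  proof induction
    case (insert i A)
    have "D i x + (\<Sum>i\<in>A. D i x) = (\<Union>a\<in>D i x. \<Union>b\<in>(\<Sum>i\<in>A. D i x). {a + b})"
      by (auto simp: set_plus_def)
    then show ?case using insert D_compact compact_sums'[of "D i x" "\<Sum>i\<in>A. D i x"] by auto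
  qed (simp add: set_zero)
  then have "compact (\<Sum>i=1..N. D i x)" by blast
  then have "closed (\<Union>a\<in>(\<Sum>i=1..N. D i x). \<Union>b\<in>convex_subdifferential g x. {a + b})"
    by (rule compact_closed_sums[OF _ closed_subdifferential])
  moreover have "total_field N D g x = (\<Union>a\<in>(\<Sum>i=1..N. D i x). \<Union>b\<in>convex_subdifferential g x. {a + b})"
    by (auto simp: set_plus_def total_field_def)
  ultimately show ?thesis by simp
qed

text \<open>Local boundedness supplies the bound on values that the closed graph criterion asks for;
  the minimum with 1 in the radius keeps \<open>z\<close> where this bound holds.\<close>

lemma D_upper_semicontinuous:
  assumes i: "i \<in> {1..N}" and e: "e > 0"
  shows "\<exists>\<eta>>0. \<forall>z v. dist z x \<le> \<eta> \<longrightarrow> v \<in> D i z \<longrightarrow> (\<exists>v'\<in>D i x. dist v v' \<le> e)"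
proof -
  obtain M where M: "\<And>z v. dist z x \<le> 1 \<Longrightarrow> v \<in> D i z \<Longrightarrow> norm v \<le> M"
    using bounded_locally_bounded_map_near[OF D_bounded[OF i], of x 1] by blast
  have "closed {(x, v). v \<in> D i x}" using D_conservative[OF i] by (simp add: conservative_field_def)
  from closed_graph_upper_semicontinuous[OF this e, of x 0 M]
  obtain \<eta> where "\<eta> > 0" and \<eta>: "\<And>z v. dist z x \<le> \<eta> \<Longrightarrow> v \<in> D i z \<Longrightarrow> norm v \<le> M \<Longrightarrow> \<exists>v'\<in>D i x. dist v v' \<le> e"
    unfolding mem_Collect_eq case_prod_conv dist_0_norm by blast
  then show ?thesis using M by (intro exI[of _ "min \<eta> 1"]) auto
qed

text \<open>Each of the N + 1 summands, possibly taken at its own point, is moved to the common base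
  point \<open>x\<close> at a cost of \<open>e = \<rho> / (N + 1)\<close>. The radius is the
  smallest of the finitely many radii that allow this.\<close>

lemma enlarged_field_upper_semicontinuous:
  assumes \<rho>: "\<rho> > 0"
  shows "\<exists>\<eta>>0. enlarged_field B \<eta> x \<subseteq> total_field N D g x + cball 0 \<rho>"
proof -
  define e where "e = \<rho> / real (N + 1)"
  have e: "e > 0" using \<rho> by (simp add: e_def)
  obtain \<eta> where \<eta>: "\<And>i. i \<in> {1..N} \<Longrightarrow> \<eta> i > 0"
    "\<And>i z v. i \<in> {1..N} \<Longrightarrow> dist z x \<le> \<eta> i \<Longrightarrow> v \<in> D i z \<Longrightarrow> \<exists>v'\<in>D i x. dist v v' \<le> e"
    using D_upper_semicontinuous[OF _ e, of _ x] by metis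
  from closed_graph_upper_semicontinuous[OF closed_subdifferential_graph e, of x 0 B]
  obtain \<eta>' where \<eta>': "\<eta>' > 0" "\<And>z w. dist z x \<le> \<eta>' \<Longrightarrow> w \<in> convex_subdifferential g z \<Longrightarrow> norm w \<le> B \<Longrightarrow>
      \<exists>w'\<in>convex_subdifferential g x. dist w w' \<le> e"
    unfolding mem_Collect_eq case_prod_conv dist_0_norm by blast
  define m where "m = Min (insert \<eta>' (\<eta> ` {1..N}))"
  have m: "m > 0" using \<eta> \<eta>' by (simp add: m_def)
  have mle: "m \<le> \<eta>'" "\<And>i. i \<in> {1..N} \<Longrightarrow> m \<le> \<eta> i"
    unfolding m_def by (rule Min_le; simp)+
  have "u \<in> total_field N D g x + cball 0 \<rho>" if u: "u \<in> enlarged_field B m x" for u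
  proof -
    from u obtain v w where vw: "u = (\<Sum>i=1..N. v i) + w \<and>
        (\<forall>i\<in>{1..N}. \<exists>z. dist z x \<le> m \<and> v i \<in> D i z) \<and>
        (\<exists>z. dist z x \<le> m \<and> w \<in> convex_subdifferential g z) \<and> norm w \<le> B"
      unfolding enlarged_field_def mem_Collect_eq by (elim exE)
    have "\<exists>v'. v' \<in> D i x \<and> dist (v i) v' \<le> e" if i: "i \<in> {1..N}" for i
    proof -
      obtain z where "dist z x \<le> m" "v i \<in> D i z" using vw i by blast
      then show ?thesis using \<eta>(2)[OF i, of z "v i"] mle(2)[OF i] by auto
    qed
    then obtain v' where v': "\<And>i. i \<in> {1..N} \<Longrightarrow> v' i \<in> D i x" "\<And>i. i \<in> {1..N} \<Longrightarrow> dist (v i) (v' i) \<le> e"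
      by metis
    obtain w' where w': "w' \<in> convex_subdifferential g x" "dist w w' \<le> e"
    proof -
      obtain z where "dist z x \<le> m" "w \<in> convex_subdifferential g z" using vw by blast
      then show ?thesis using that \<eta>'(2)[of z w] vw mle(1) by auto
    qed
    have "norm (u - ((\<Sum>i=1..N. v' i) + w')) = norm ((\<Sum>i=1..N. v i - v' i) + (w - w'))"
      by (simp add: vw sum_subtractf algebra_simps)
    also have "\<dots> \<le> norm (\<Sum>i=1..N. v i - v' i) + norm (w - w')" by (rule norm_triangle_ineq)
    also have "norm (\<Sum>i=1..N. v i - v' i) \<le> (\<Sum>i=1..N. e)"
      using v'(2) by (intro sum_norm_le) (simp add: dist_norm)
    also have "(\<Sum>i=1..N. e) + norm (w - w') \<le> real N * e + e"
      using w'(2) by (simp add: dist_norm)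
    also have "\<dots> = real (N + 1) * e" by (simp add: algebra_simps)
    also have "\<dots> = \<rho>" by (simp add: e_def)
    finally have "u - ((\<Sum>i=1..N. v' i) + w') \<in> cball 0 \<rho>" by simp
    moreover have "(\<Sum>i=1..N. v' i) + w' \<in> total_field N D g x"
      unfolding total_field_iff using v'(1) w'(1) by blast
    ultimately have "((\<Sum>i=1..N. v' i) + w') + (u - ((\<Sum>i=1..N. v' i) + w')) \<in> total_field N D g x + cball 0 \<rho>"
      by (rule set_plus_intro[rotated])
    then show ?thesis by simp
  qed
  then show ?thesis using m by blast
qed

end

section \<open>Interpolation of discrete trajectories\<close>

text \<open>The piecewise linear interpolation of the iterates \<open>x\<close> in the time \<open>\<Sum>\<alpha>\<close>, stopped when the
  time reaches \<open>\<tau>\<close> or the iterates leave the ball of radius \<open>\<rho>\<close>, and rescaled to \<open>[0,1]\<close>. It is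
  written as \<open>x 0 + (\<Sum>k<K. c k *\<^sub>R u k)\<close>, where \<open>u k\<close> is the velocity in step \<open>k\<close> and \<open>c k\<close> the time
  spent in it, so that increments are visibly convex combinations of velocities.\<close>

lemma interpolated_curve:
  fixes x :: "nat \<Rightarrow> 'a::euclidean_space" and \<alpha> :: "nat \<Rightarrow> real" and E :: "real \<Rightarrow> 'a \<Rightarrow> 'a set"
  assumes \<alpha>: "\<And>k. 0 < \<alpha> k" "\<And>k. \<alpha> k \<le> \<beta>"
    and div: "filterlim (\<lambda>n. \<Sum>k<n. \<alpha> k) at_top sequentially"
    and pos: "\<tau> > 0" "\<rho> > 0" "B > 0"
    and mono: "\<And>r s p q. r + dist p q \<le> s \<Longrightarrow> E r p \<subseteq> E s q"
    and step: "\<And>k. dist (x k) (x 0) < \<rho> \<Longrightarrow> dist (x k) (x (Suc k)) \<le> B * \<alpha> k"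
      "\<And>k. dist (x k) (x 0) < \<rho> \<Longrightarrow> (1 / \<alpha> k) *\<^sub>R (x k - x (Suc k)) \<in> E (B * \<beta>) (x k)"
  obtains T \<gamma> where "min \<tau> (\<rho> / B) \<le> T" "T \<le> \<tau> + \<beta>" "\<gamma> 0 = x 0" "(B * T)-lipschitz_on {0..1} \<gamma>"
    "\<tau> \<le> T \<or> \<rho> \<le> dist (\<gamma> 1) (\<gamma> 0)"
    "\<And>s. s \<in> {0..1} \<Longrightarrow> \<exists>k. dist (x k) (\<gamma> s) \<le> B * \<beta>"
    "\<And>s s'. 0 \<le> s \<Longrightarrow> s < s' \<Longrightarrow> s' \<le> 1 \<Longrightarrow>
      (1 / (T * (s' - s))) *\<^sub>R (\<gamma> s - \<gamma> s') \<in> convex hull (E (B * (2 * \<beta> + T * (s' - s))) (\<gamma> s))"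
proof -
  define t where "t = (\<lambda>n. \<Sum>k<n. \<alpha> k)"
  have t0: "t 0 = 0" and tS: "t (Suc k) = t k + \<alpha> k" for k by (auto simp: t_def)
  have tmono: "t i \<le> t j" if "i \<le> j" for i j
    using that by (induction rule: dec_induct) (use \<alpha>(1) in \<open>auto simp: tS intro: add_increasing2 less_imp_le\<close>)
  have tnn: "0 \<le> t k" for k using tmono[of 0 k] t0 by simp
  \<comment> \<open>\<open>Q\<close> is the stopping criterion and \<open>K\<close> the first index
    that meets it; the estimates for single steps are available before \<open>K\<close>. Index 0
    does not qualify, since \<tau> and \<rho> are positive.\<close>
  define Q where "Q = (\<lambda>K. \<tau> \<le> t K \<or> \<rho> \<le> dist (x K) (x 0))"
  have "\<exists>K. Q K"
    using div[unfolded filterlim_at_top, rule_format, of \<tau>]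
    by (auto simp: eventually_sequentially Q_def t_def)
  define K where "K = (LEAST K. Q K)"
  have QK: "Q K" unfolding K_def by (rule LeastI_ex[OF \<open>\<exists>K. Q K\<close>])
  have notQ: "t k < \<tau>" "dist (x k) (x 0) < \<rho>" if "k < K" for k
    using not_less_Least[of k Q] that by (auto simp: Q_def K_def)
  have K0: "K > 0"
    using QK pos t0 by (cases K) (auto simp: Q_def)
  define T where "T = t K"
  obtain K' where K': "K = Suc K'" using K0 by (cases K) auto
  \<comment> \<open>Before the last step the time was still below \<tau>, so the overshoot is at
    most one step size.\<close>
  have T\<tau>: "T \<le> \<tau> + \<beta>"
    using notQ(1)[of K'] \<alpha>(2)[of K'] by (simp add: T_def K' tS)
  have T0: "T > 0" using tS[of K'] tnn[of K'] \<alpha>(1)[of K'] by (simp add: T_def K')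
  define u where "u = (\<lambda>k. (1 / \<alpha> k) *\<^sub>R (x (Suc k) - x k))"
  have u: "norm (u k) \<le> B" if "k < K" for k
    using step(1)[OF notQ(2)[OF that]] \<alpha>(1)[of k] unfolding u_def norm_scaleR
    by (simp add: dist_norm norm_minus_commute pos_divide_le_eq)
  have uE: "- u k \<in> E (B * \<beta>) (x k)" if "k < K" for k
  proof -
    have "- u k = (1 / \<alpha> k) *\<^sub>R (x k - x (Suc k))" by (simp add: u_def algebra_simps)
    then show ?thesis using step(2)[OF notQ(2)[OF that]] by simp
  qed
  \<comment> \<open>\<open>c a k\<close> is the length of the part of step \<open>k\<close> that
    lies before time \<open>a\<close>. The bound variable \<tau> shadows the stopping time.\<close>
  define c where "c = (\<lambda>\<tau> k. min \<tau> (t (Suc k)) - min \<tau> (t k))"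
  have c_mono: "c a k \<le> c b k" if "a \<le> b" for a b k
    using that tS[of k] \<alpha>(1)[of k] by (auto simp: c_def min_def)
  have c_sum: "(\<Sum>k<K. c a k) = a" if "0 \<le> a" "a \<le> T" for a
    using that unfolding c_def by (subst sum_lessThan_telescope) (auto simp: t0 T_def)
  define \<Gamma> where "\<Gamma> = (\<lambda>a. x 0 + (\<Sum>k<K. c a k *\<^sub>R u k))"
  have \<Gamma>diff: "\<Gamma> b - \<Gamma> a = (\<Sum>k<K. (c b k - c a k) *\<^sub>R u k)" for a b
    by (simp add: \<Gamma>_def scaleR_diff_left sum_subtractf)
  have \<Gamma>lip: "dist (\<Gamma> a) (\<Gamma> b) \<le> B * (b - a)" if ab: "0 \<le> a" "a \<le> b" "b \<le> T" for a b
  proof -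
    have "dist (\<Gamma> a) (\<Gamma> b) = norm (\<Gamma> b - \<Gamma> a)" by (simp add: dist_norm norm_minus_commute)
    also have "\<dots> \<le> (\<Sum>k<K. (c b k - c a k) * B)"
      unfolding \<Gamma>diff
    proof (rule sum_norm_le)
      fix k assume "k \<in> {..<K}"
      then show "norm ((c b k - c a k) *\<^sub>R u k) \<le> (c b k - c a k) * B"
        using c_mono[OF ab(2), of k] u[of k] by (simp add: mult_left_mono)
    qed
    also have "\<dots> = B * (b - a)"
      using c_sum[of a] c_sum[of b] ab by (simp add: sum_distrib_right[symmetric] sum_subtractf)
    finally show ?thesis .
  qed
  have \<Gamma>t: "\<Gamma> (t k) = x k" if "k \<le> K" for k
  proof -
    have "(\<Sum>j<K. c (t k) j *\<^sub>R u j) = (\<Sum>j<k. x (Suc j) - x j)"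
    proof (rule sum.mono_neutral_cong_right)
      show "\<forall>j\<in>{..<K} - {..<k}. c (t k) j *\<^sub>R u j = 0"
        using tmono by (auto simp: c_def min_absorb1)
      fix j assume "j \<in> {..<k}"
      then have "c (t k) j = \<alpha> j"
        using tmono[of j k] tmono[of "Suc j" k] tS[of j] by (simp add: c_def)
      then show "c (t k) j *\<^sub>R u j = x (Suc j) - x j"
        using \<alpha>(1)[of j] by (simp add: u_def)
    qed (use that in auto)
    then show ?thesis by (simp add: \<Gamma>_def sum_lessThan_telescope)
  qed
  have tT: "t k \<le> T" if "k \<le> K" for k using tmono[OF that] by (simp add: T_def)
  have near: "\<exists>k. dist (x k) (\<Gamma> a) \<le> B * \<beta>" if a: "0 \<le> a" "a \<le> T" for a
  proof (cases "a = T")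
    case True
    then show ?thesis using \<Gamma>t[of K] pos \<alpha>[of 0] by (intro exI[of _ K]) (simp add: T_def)
  next
    case False
    \<comment> \<open>\<open>k\<close> is the step in progress at time \<open>a\<close>. At the
      final time there may be no such step before \<open>K\<close>, which is why that time is
      treated separately.\<close>
    define k where "k = (LEAST k. a < t (Suc k))"
    have ex: "a < t (Suc K')" using a False by (simp add: T_def K')
    then have k: "a < t (Suc k)" "k \<le> K'" unfolding k_def by (rule LeastI, rule Least_le)
    have "t k \<le> a"
    proof (cases k)
      case (Suc j)
      then show ?thesis using not_less_Least[of j "\<lambda>k. a < t (Suc k)"] by (auto simp: k_def)
    qed (use t0 a in simp)
    then have "dist (x k) (\<Gamma> a) \<le> B * (a - t k)"
      using \<Gamma>lip[of "t k" a] \<Gamma>t[of k] k K' tnn a by simp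
    also have "\<dots> \<le> B * \<beta>" using pos k tS[of k] \<alpha>(2)[of k] by (intro mult_left_mono) auto
    finally show ?thesis by blast
  qed
  have hull: "(1 / (b - a)) *\<^sub>R (\<Gamma> a - \<Gamma> b) \<in> convex hull (E (B * (2 * \<beta> + (b - a))) (\<Gamma> a))"
    if ab: "0 \<le> a" "a < b" "b \<le> T" for a b
  proof -
    \<comment> \<open>\<open>w k\<close> is the fraction of the time between \<open>a\<close> and
      \<open>b\<close> that is spent in step \<open>k\<close>. Restriction to the support
      \<open>J\<close> leaves only steps that overlap this time interval, and their base points are
      close to \<open>\<Gamma> a\<close>.\<close>
    define w where "w = (\<lambda>k. (c b k - c a k) / (b - a))"
    define J where "J = {k \<in> {..<K}. w k \<noteq> 0}"
    have w0: "w k \<ge> 0" for k using c_mono[of a b k] ab by (simp add: w_def)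
    have "(\<Sum>k<K. w k) = 1"
      using c_sum[of a] c_sum[of b] ab by (simp add: w_def sum_divide_distrib[symmetric] sum_subtractf)
    then have w1: "(\<Sum>k\<in>J. w k) = 1"
      unfolding J_def by (subst sum.mono_neutral_left[of "{..<K}"]) auto
    have "(1 / (b - a)) *\<^sub>R (\<Gamma> a - \<Gamma> b) = - ((1 / (b - a)) *\<^sub>R (\<Gamma> b - \<Gamma> a))"
      by (simp add: algebra_simps)
    also have "\<dots> = (\<Sum>k<K. w k *\<^sub>R (- u k))"
      unfolding \<Gamma>diff by (simp add: w_def scaleR_sum_right sum_negf)
    also have "\<dots> = (\<Sum>k\<in>J. w k *\<^sub>R (- u k))"
      unfolding J_def by (rule sum.mono_neutral_right) auto
    also have "\<dots> \<in> convex hull (E (B * (2 * \<beta> + (b - a))) (\<Gamma> a))"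
    proof (rule convex_sum[OF _ convex_convex_hull w1 w0])
      fix k assume k: "k \<in> J"
      then have kK: "k < K" by (simp add: J_def)
      have "c b k \<noteq> c a k" using k ab by (auto simp: J_def w_def)
      then have tk: "t k < b" "a < t (Suc k)"
        using ab tS[of k] \<alpha>(1)[of k] by (auto simp: c_def min_def split: if_splits)
      \<comment> \<open>A step in progress at time \<open>a\<close> began at most \<beta> earlier,
        and any later step in \<open>J\<close> begins before \<open>b\<close>. Together with the
        radius \<open>B * \<beta>\<close> of the step itself this produces the factor
        \<open>2 * \<beta> + (b - a)\<close>.\<close>
      have d: "dist (x k) (\<Gamma> a) \<le> B * (\<beta> + (b - a))"
      proof (cases "t k \<le> a")
        case True
        have "dist (x k) (\<Gamma> a) \<le> B * (a - t k)"
          using \<Gamma>lip[of "t k" a] \<Gamma>t[of k] kK True tnn ab by simp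
        also have "\<dots> \<le> B * (\<beta> + (b - a))"
          using pos tk tS[of k] \<alpha>(2)[of k] ab by (intro mult_left_mono) auto
        finally show ?thesis .
      next
        case False
        have "dist (\<Gamma> a) (x k) \<le> B * (t k - a)"
          using \<Gamma>lip[of a "t k"] \<Gamma>t[of k] kK False tT[of k] ab by simp
        also have "\<dots> \<le> B * (\<beta> + (b - a))"
          using pos tk \<alpha>[of k] ab by (intro mult_left_mono) auto
        finally show ?thesis by (simp add: dist_commute)
      qed
      have "E (B * \<beta>) (x k) \<subseteq> E (B * (2 * \<beta> + (b - a))) (\<Gamma> a)"
        by (rule mono) (use d in \<open>simp add: algebra_simps\<close>)
      then show "- u k \<in> convex hull (E (B * (2 * \<beta> + (b - a))) (\<Gamma> a))"
        using uE[OF kK] by (intro hull_inc) (rule subsetD)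
    qed (simp add: J_def)
    finally show ?thesis .
  qed
  define \<gamma> where "\<gamma> = (\<lambda>s. \<Gamma> (T * s))"
  have sT: "0 \<le> T * s" "T * s \<le> T" if "s \<in> {0..1}" for s
    using that T0 mult_left_mono[of s 1 T] by auto
  have lip: "dist (\<gamma> r) (\<gamma> s) \<le> B * T * (s - r)" if "0 \<le> r" "r \<le> s" "s \<le> 1" for r s
    using \<Gamma>lip[of "T * r" "T * s"] that T0 sT[of r] sT[of s] unfolding \<gamma>_def
    by (simp add: mult_left_mono algebra_simps)
  have \<gamma>0: "\<gamma> 0 = x 0" using \<Gamma>t[of 0] t0 by (simp add: \<gamma>_def)
  have \<gamma>1: "\<gamma> 1 = x K" using \<Gamma>t[of K] by (simp add: \<gamma>_def T_def)
  have exit: "\<tau> \<le> T \<or> \<rho> \<le> dist (\<gamma> 1) (\<gamma> 0)"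
    using QK by (simp add: Q_def \<gamma>0 \<gamma>1 T_def)
  show ?thesis
  proof (rule that[of T \<gamma>])
    \<comment> \<open>At speed at most \<open>B\<close>, leaving the ball of radius \<rho> takes at
      least the time \<open>\<rho> / B\<close>. This lower bound keeps durations away from 0 in the
      limit.\<close>
    show "min \<tau> (\<rho> / B) \<le> T"
      using exit
    proof
      assume "\<rho> \<le> dist (\<gamma> 1) (\<gamma> 0)"
      also have "\<dots> \<le> B * T" using lip[of 0 1] by (simp add: dist_commute)
      finally have "\<rho> / B \<le> T" using pos by (simp add: field_simps)
      then show ?thesis by simp
    qed simp
    show "(B * T)-lipschitz_on {0..1} \<gamma>"
    proof (rule lipschitz_onI)
      fix r s :: real assume rs: "r \<in> {0..1}" "s \<in> {0..1}"
      show "dist (\<gamma> r) (\<gamma> s) \<le> B * T * dist r s"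
        using lip[of r s] lip[of s r] rs by (cases "r \<le> s") (auto simp: dist_real_def dist_commute)
    qed (use pos T0 in simp)
    show "\<exists>k. dist (x k) (\<gamma> s) \<le> B * \<beta>" if "s \<in> {0..1}" for s
      using near[OF sT[OF that]] by (simp add: \<gamma>_def)
    show "(1 / (T * (s' - s))) *\<^sub>R (\<gamma> s - \<gamma> s') \<in> convex hull (E (B * (2 * \<beta> + T * (s' - s))) (\<gamma> s))"
      if "0 \<le> s" "s < s'" "s' \<le> 1" for s s'
      using hull[of "T * s" "T * s'"] that T0 sT[of s] sT[of s'] by (simp add: \<gamma>_def right_diff_distrib)
  qed (use T\<tau> \<gamma>0 exit in auto)
qed

context prr_setting
begin

section \<open>One epoch of proximal random reshuffling\<close>

text \<open>The subgradient inequality at \<open>z\<close>, tested with \<open>x\<close>, bounds the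
  square of the step length \<open>s\<close> by \<alpha> times a sum of an inner product with
  \<open>p\<close> and the decrease of \<open>G\<close>. Both terms are at most linear in
  \<open>s\<close>, so one factor \<open>s\<close> cancels.\<close>

lemma prox_step_bound:
  assumes L: "L-lipschitz_on (effective_domain g \<inter> cball 0 (R + 1)) G"
    and x: "x \<in> effective_domain g" "norm x \<le> R"
    and \<alpha>: "\<alpha> > 0" and z: "z \<in> prox (\<lambda>z. ereal \<alpha> * g z) (x - \<alpha> *\<^sub>R p)"
  shows "norm (x - z) \<le> \<alpha> * (norm p + L)"
proof -
  define s where "s = norm (x - z)"
  have w: "(1 / \<alpha>) *\<^sub>R (x - \<alpha> *\<^sub>R p - z) \<in> convex_subdifferential g z"
    by (rule prox_subgradient[OF \<alpha> z])
  then have zd: "z \<in> effective_domain g" by (simp add: subdifferential_iff)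
  have LG: "G x - G q \<le> L * norm (x - q)" if "q \<in> effective_domain g" "norm (x - q) \<le> 1" for q
  proof -
    have "q \<in> cball 0 (R + 1)"
      using that x(2) norm_triangle_ineq4[of x "x - q"] by simp
    then have "dist (G x) (G q) \<le> L * dist x q"
      using that x by (intro lipschitz_onD[OF L]) auto
    then show ?thesis by (simp add: dist_norm)
  qed
  have GL: "G x - G z \<le> L * s"
  proof (cases "s \<le> 1")
    case True
    then show ?thesis using LG[OF zd] by (simp add: s_def)
  next
    case False
    \<comment> \<open>The Lipschitz bound reaches only to distance 1 from \<open>x\<close>. When
      \<open>z\<close> is farther away, \<open>q\<close> is the point of the segment at distance
      exactly 1, and convexity extends the bound on the decrease from \<open>q\<close> to
      \<open>z\<close>.\<close>
    define q where "q = x + (1 / s) *\<^sub>R (z - x)"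
    have q: "q \<in> effective_domain g" "G q \<le> G x + (1 / s) * (G z - G x)"
      unfolding q_def using False by (intro G_convex x zd; simp)+
    have "norm (x - q) = 1"
      using False by (auto simp: q_def s_def norm_minus_commute)
    then have "G x - G q \<le> L" using LG[OF q(1)] by simp
    then have "(1 / s) * (G x - G z) \<le> L" using q(2) by (simp add: right_diff_distrib)
    then show ?thesis using False by (simp add: pos_divide_le_eq)
  qed
  have "G z + ((1 / \<alpha>) *\<^sub>R (x - \<alpha> *\<^sub>R p - z)) \<bullet> (x - z) \<le> G x"
    using w x by (simp add: subdifferential_iff)
  then have "(1 / \<alpha>) * ((x - \<alpha> *\<^sub>R p - z) \<bullet> (x - z)) \<le> G x - G z" by simp
  then have "(x - \<alpha> *\<^sub>R p - z) \<bullet> (x - z) \<le> \<alpha> * (G x - G z)"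
    using \<alpha> by (simp add: pos_divide_le_eq mult.commute)
  also have "\<dots> \<le> \<alpha> * (L * s)" using GL \<alpha> by simp
  also have "(x - \<alpha> *\<^sub>R p - z) \<bullet> (x - z) = s\<^sup>2 - \<alpha> * (p \<bullet> (x - z))"
    by (simp add: s_def power2_norm_eq_inner inner_diff_left algebra_simps)
  finally have "s\<^sup>2 \<le> \<alpha> * (p \<bullet> (x - z)) + \<alpha> * (L * s)" by simp
  also have "\<alpha> * (p \<bullet> (x - z)) \<le> \<alpha> * (norm p * s)"
    unfolding s_def using \<alpha> by (intro mult_left_mono norm_cauchy_schwarz) simp
  finally have "s * s \<le> (\<alpha> * (norm p + L)) * s" by (simp add: power2_eq_square algebra_simps)
  moreover have "s \<ge> 0" by (simp add: s_def)
  moreover have "\<alpha> * (norm p + L) \<ge> 0" using \<alpha> lipschitz_on_nonneg[OF L] by simp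
  ultimately show ?thesis unfolding s_def[symmetric] by (cases "s = 0") auto
qed

text \<open>An epoch is treated as one step from \<open>x\<close>: the directions are taken at the
  inner iterates and the subgradient at \<open>z\<close>, all within \<open>B * \<alpha>\<close> of
  \<open>x\<close>. The constant \<open>B\<close> depends on the radius \<open>R\<close> but not on
  the step size, the permutation or the choices made in the epoch.\<close>

lemma prr_step:
  obtains B where "B > 0"
    "\<And>\<alpha> x y z \<sigma>. \<lbrakk>x \<in> effective_domain g; norm x \<le> R; 0 < \<alpha>; B * \<alpha> \<le> 1; \<sigma> permutes {1..N}; y 0 = x;
      \<forall>i\<in>{1..N}. y i \<in> (\<lambda>v. y (i - 1) - \<alpha> *\<^sub>R v) ` D (\<sigma> i) (y (i - 1));
      z \<in> prox (\<lambda>z. ereal \<alpha> * g z) (y N)\<rbrakk> \<Longrightarrow>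
      z \<in> effective_domain g \<and> dist x z \<le> B * \<alpha> \<and> (1 / \<alpha>) *\<^sub>R (x - z) \<in> enlarged_field B (B * \<alpha>) x"
proof -
  have "\<exists>M. \<forall>z v. dist z 0 \<le> R + 1 \<longrightarrow> v \<in> D i z \<longrightarrow> norm v \<le> M" if "i \<in> {1..N}" for i
    using bounded_locally_bounded_map_near[OF D_bounded[OF that]] by metis
  then obtain m where m: "\<And>i z v. i \<in> {1..N} \<Longrightarrow> dist z 0 \<le> R + 1 \<Longrightarrow> v \<in> D i z \<Longrightarrow> norm v \<le> m i"
    by metis
  define M where "M = (\<Sum>i=1..N. \<bar>m i\<bar>)"
  have M0: "M \<ge> 0" unfolding M_def by (intro sum_nonneg) simp
  have M: "norm v \<le> M" if "i \<in> {1..N}" "norm z \<le> R + 1" "v \<in> D i z" for i z v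
  proof -
    have "norm v \<le> m i" using m that by simp
    also have "\<dots> \<le> \<bar>m i\<bar>" by simp
    also have "\<dots> \<le> M" unfolding M_def using that(1) by (intro member_le_sum) auto
    finally show ?thesis .
  qed
  have "compact (effective_domain g \<inter> cball 0 (R + 1))"
    using g_dom_closed by (intro closed_Int_compact) auto
  moreover have "locally_lipschitz_on (effective_domain g \<inter> cball 0 (R + 1)) G"
    by (rule locally_lipschitz_on_subset[OF G_locally_lipschitz]) simp
  ultimately obtain L where L: "L-lipschitz_on (effective_domain g \<inter> cball 0 (R + 1)) G"
    by (metis locally_lipschitz_on_compact)
  have L0: "L \<ge> 0" by (rule lipschitz_on_nonneg[OF L])
  \<comment> \<open>\<open>N * M + L\<close> bounds the velocity of the epoch; the subgradient is
    that velocity minus the sum of the directions, which costs another \<open>N * M\<close>. The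
    final 1 ensures positivity.\<close>
  define B where "B = 2 * (real N * M) + L + 1"
  have NM: "0 \<le> real N * M" using M0 by simp
  show thesis
  proof (rule that[of B])
    show "B > 0" using NM L0 by (simp add: B_def)
    fix \<alpha> :: real and x z :: 'a and y :: "nat \<Rightarrow> 'a" and \<sigma> :: "nat \<Rightarrow> nat"
    assume x: "x \<in> effective_domain g" "norm x \<le> R" and \<alpha>: "0 < \<alpha>" "B * \<alpha> \<le> 1"
      and \<sigma>: "\<sigma> permutes {1..N}" and y0: "y 0 = x"
      and y: "\<forall>i\<in>{1..N}. y i \<in> (\<lambda>v. y (i - 1) - \<alpha> *\<^sub>R v) ` D (\<sigma> i) (y (i - 1))"
      and z: "z \<in> prox (\<lambda>z. ereal \<alpha> * g z) (y N)"
    have \<sigma>in: "\<sigma> i \<in> {1..N}" if "i \<in> {1..N}" for i using permutes_in_image[OF \<sigma>] that by blast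
    from y obtain v where v: "\<And>i. i \<in> {1..N} \<Longrightarrow> v i \<in> D (\<sigma> i) (y (i - 1))"
      "\<And>i. i \<in> {1..N} \<Longrightarrow> y i = y (i - 1) - \<alpha> *\<^sub>R v i"
      unfolding image_iff by metis
    have BN: "real N * M \<le> B" "real N * M + L \<le> B" using NM L0 unfolding B_def by linarith+
    have "\<alpha> * (real N * M) \<le> \<alpha> * B" using \<alpha> BN(1) by simp
    then have \<alpha>NM: "\<alpha> * (real N * M) \<le> B * \<alpha>" by (simp add: mult.commute)
    have iN: "\<alpha> * (real i * M) \<le> \<alpha> * (real N * M)" if "i \<le> N" for i
      using that \<alpha> M0 by (intro mult_left_mono mult_right_mono) auto
    \<comment> \<open>The induction hypothesis and \<open>B * \<alpha> \<le> 1\<close> keep the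
      current inner iterate in the ball of radius \<open>R + 1\<close>, where \<open>M\<close>
      bounds the next direction.\<close>
    have yx: "norm (y i - x) \<le> \<alpha> * (real i * M)" if "i \<le> N" for i
      using that
    proof (induction i)
      case (Suc i)
      then have IH: "norm (y i - x) \<le> \<alpha> * (real i * M)" and i: "Suc i \<in> {1..N}" by auto
      have "norm (y i) \<le> R + 1"
        using IH iN[of i] Suc.prems \<alpha>NM \<alpha>(2) x(2) norm_triangle_ineq[of "y i - x" x] by simp
      then have vM: "norm (v (Suc i)) \<le> M" using M[OF \<sigma>in[OF i]] v(1)[OF i] by simp
      have "norm (y (Suc i) - x) = norm ((y i - x) - \<alpha> *\<^sub>R v (Suc i))"
        by (simp add: v(2)[OF i] algebra_simps)
      also have "\<dots> \<le> norm (y i - x) + norm (\<alpha> *\<^sub>R v (Suc i))" by (rule norm_triangle_ineq4)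
      also have "\<dots> \<le> \<alpha> * (real i * M) + \<alpha> * M"
        using IH vM \<alpha> by (intro add_mono) auto
      finally show ?case by (simp add: algebra_simps)
    qed (simp add: y0)
    have yxB: "dist (y i) x \<le> B * \<alpha>" if "i \<le> N" for i
      using yx[OF that] iN[OF that] \<alpha>NM by (simp add: dist_norm)
    have vM: "norm (v i) \<le> M" if i: "i \<in> {1..N}" for i
    proof (rule M[OF \<sigma>in[OF i] _ v(1)[OF i]])
      have "norm (y (i - 1)) \<le> norm (y (i - 1) - x) + norm x"
        using norm_triangle_ineq[of "y (i - 1) - x" x] by simp
      also have "norm (y (i - 1) - x) \<le> B * \<alpha>"
        unfolding dist_norm[symmetric] using i by (intro yxB) auto
      finally show "norm (y (i - 1)) \<le> R + 1"
        using x(2) \<alpha>(2) by simp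
    qed
    have ysum: "y i = x - \<alpha> *\<^sub>R (\<Sum>j=1..i. v j)" if "i \<le> N" for i
      using that
    proof (induction i)
      case (Suc i)
      then have "y (Suc i) = x - \<alpha> *\<^sub>R (\<Sum>j=1..i. v j) - \<alpha> *\<^sub>R v (Suc i)" using v(2)[of "Suc i"] by simp
      then show ?case by (simp add: scaleR_add_right)
    qed (simp add: y0)
    define p where "p = (\<Sum>j=1..N. v j)"
    have yN: "y N = x - \<alpha> *\<^sub>R p" using ysum[of N] by (simp add: p_def)
    have "norm p \<le> (\<Sum>j=1..N. M)" unfolding p_def by (intro sum_norm_le vM)
    then have p: "norm p \<le> real N * M" by simp
    have xz: "norm (x - z) \<le> \<alpha> * (norm p + L)"
      by (rule prox_step_bound[OF L x \<alpha>(1)]) (use z yN in simp)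
    also have "\<dots> \<le> \<alpha> * (real N * M + L)" using p \<alpha> by simp
    finally have xz': "norm (x - z) \<le> \<alpha> * (real N * M + L)" .
    also have "\<dots> \<le> \<alpha> * B" using \<alpha> BN(2) by simp
    finally have xzB: "dist x z \<le> B * \<alpha>" by (simp add: dist_norm mult.commute)
    define w where "w = (1 / \<alpha>) *\<^sub>R (y N - z)"
    have w: "w \<in> convex_subdifferential g z" unfolding w_def by (rule prox_subgradient[OF \<alpha>(1) z])
    have eq: "(1 / \<alpha>) *\<^sub>R (x - z) = p + w"
      using \<alpha>(1) by (simp add: w_def yN algebra_simps)
    have "norm w = norm ((1 / \<alpha>) *\<^sub>R (x - z) - p)" by (simp add: eq)
    also have "\<dots> \<le> norm ((1 / \<alpha>) *\<^sub>R (x - z)) + norm p" by (rule norm_triangle_ineq4)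
    also have "norm ((1 / \<alpha>) *\<^sub>R (x - z)) \<le> real N * M + L"
      unfolding norm_scaleR using xz' \<alpha>(1) by (simp add: pos_divide_le_eq mult.commute)
    finally have wB: "norm w \<le> B" using p by (simp add: B_def)
    \<comment> \<open>Each index is used exactly once per epoch, so reindexing by the inverse
      permutation sorts the directions by component and yields one element for every
      \<open>D i\<close>.\<close>
    have pv: "p = (\<Sum>i=1..N. (v \<circ> inv \<sigma>) i)"
      unfolding p_def by (subst sum.permute[OF \<sigma>, of "v \<circ> inv \<sigma>"])
        (simp add: o_assoc[symmetric] permutes_inv_o[OF \<sigma>])
    have "\<exists>z. dist z x \<le> B * \<alpha> \<and> (v \<circ> inv \<sigma>) i \<in> D i z" if i: "i \<in> {1..N}" for i
    proof (intro exI conjI)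
      have j: "inv \<sigma> i \<in> {1..N}" using permutes_in_image[OF permutes_inv[OF \<sigma>]] i by blast
      show "dist (y (inv \<sigma> i - 1)) x \<le> B * \<alpha>" using j by (intro yxB) auto
      show "(v \<circ> inv \<sigma>) i \<in> D i (y (inv \<sigma> i - 1))"
        using v(1)[OF j] permutes_inverses(1)[OF \<sigma>, of i] by simp
    qed
    moreover have "\<exists>z'. dist z' x \<le> B * \<alpha> \<and> w \<in> convex_subdifferential g z'"
      using w xzB by (auto simp: dist_commute)
    ultimately have "(1 / \<alpha>) *\<^sub>R (x - z) \<in> enlarged_field B (B * \<alpha>) x"
      unfolding eq pv by (rule enlarged_fieldI[OF _ _ wB])
    then show "z \<in> effective_domain g \<and> dist x z \<le> B * \<alpha> \<and> (1 / \<alpha>) *\<^sub>R (x - z) \<in> enlarged_field B (B * \<alpha>) x"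
      using w xzB by (simp add: subdifferential_iff)
  qed
qed

end

section \<open>Descent along limit curves\<close>

lemma lipschitz_on_sum:
  fixes f :: "'i \<Rightarrow> 'a::metric_space \<Rightarrow> 'b::real_normed_vector"
  assumes "finite I" "\<And>i. i \<in> I \<Longrightarrow> \<exists>L. L-lipschitz_on S (f i)"
  shows "\<exists>L. L-lipschitz_on S (\<lambda>x. \<Sum>i\<in>I. f i x)"
  using assms
proof (induction I)
  case empty
  then show ?case by (auto intro: lipschitz_on_constant)
next
  case (insert i I)
  then obtain L M where "L-lipschitz_on S (f i)" "M-lipschitz_on S (\<lambda>x. \<Sum>i\<in>I. f i x)" by blast
  then have "(L + M)-lipschitz_on S (\<lambda>x. f i x + (\<Sum>i\<in>I. f i x))" by (rule lipschitz_on_add)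
  with insert(1,2) show ?case by auto
qed

context prr_setting
begin

text \<open>The derivative exists because \<open>s \<mapsto> h s *\<^sub>R b\<close> is a Lipschitz curve, to which the definition
  of a conservative field applies.\<close>

lemma lipschitz_AE_differentiable:
  fixes h :: "real \<Rightarrow> real"
  assumes "L-lipschitz_on {0..1} h"
  shows "AE t in lborel. t \<in> {0<..<1} \<longrightarrow> (\<exists>d. (h has_real_derivative d) (at t))"
proof -
  obtain b :: 'a where b: "b \<in> Basis" by (meson nonempty_Basis ex_in_conv)
  have "L-lipschitz_on {0..1} (\<lambda>s. h s *\<^sub>R b)"
  proof (rule lipschitz_onI)
    fix x y :: real assume "x \<in> {0..1}" "y \<in> {0..1}"
    then show "dist (h x *\<^sub>R b) (h y *\<^sub>R b) \<le> L * dist x y"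
      using lipschitz_onD[OF assms, of x y] b
      by (simp add: dist_norm flip: scaleR_diff_left)
  qed (rule lipschitz_on_nonneg[OF assms])
  then have "abs_continuous_curve 0 1 (\<lambda>s. h s *\<^sub>R b)"
    by (rule lipschitz_imp_abs_continuous_curve)
  then have "AE t in lborel. t \<in> {0..1} \<longrightarrow>
      (\<exists>\<gamma>'. ((\<lambda>s. h s *\<^sub>R b) has_vector_derivative \<gamma>') (at t within {0..1}) \<and>
        (\<forall>v\<in>D 1 (h t *\<^sub>R b). ((\<lambda>s. f 1 (h s *\<^sub>R b)) has_real_derivative (v \<bullet> \<gamma>')) (at t within {0..1})))"
    using D_conservative[of 1] N_ge_1 unfolding conservative_field_def by simp
  then show ?thesis
  proof (rule AE_mp, intro AE_I2 impI)
    fix t :: real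
    assume t: "t \<in> {0<..<1}" and "t \<in> {0..1} \<longrightarrow>
      (\<exists>\<gamma>'. ((\<lambda>s. h s *\<^sub>R b) has_vector_derivative \<gamma>') (at t within {0..1}) \<and>
        (\<forall>v\<in>D 1 (h t *\<^sub>R b). ((\<lambda>s. f 1 (h s *\<^sub>R b)) has_real_derivative (v \<bullet> \<gamma>')) (at t within {0..1})))"
    then obtain d where "((\<lambda>s. h s *\<^sub>R b) has_vector_derivative d) (at t within {0..1})" by auto
    then have "((\<lambda>s. h s *\<^sub>R b) has_vector_derivative d) (at t)"
      using t by (simp add: at_within_Icc_at)
    then have "((\<lambda>s. (h s *\<^sub>R b) \<bullet> b) has_vector_derivative (d \<bullet> b)) (at t)"
      by (rule bounded_linear.has_vector_derivative[OF bounded_linear_inner_left])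
    then show "\<exists>d. (h has_real_derivative d) (at t)"
      using b by (auto simp: has_real_derivative_iff_has_vector_derivative)
  qed
qed

definition F :: "'a \<Rightarrow> real" where "F x = (\<Sum>i=1..N. f i x) + G x"

lemma F_lipschitz_on_compact:
  assumes "compact K" "K \<subseteq> effective_domain g"
  shows "\<exists>L. L-lipschitz_on K F" "\<exists>L. L-lipschitz_on K G"
proof -
  have "\<exists>L. L-lipschitz_on K (f i)" if "i \<in> {1..N}" for i
    using locally_lipschitz_on_compact[OF locally_lipschitz_on_subset[OF f_lipschitz[OF that] subset_UNIV] assms(1)]
    by metis
  then have "\<exists>L. L-lipschitz_on K (\<lambda>x. \<Sum>i=1..N. f i x)"
    by (intro lipschitz_on_sum) auto
  moreover show "\<exists>L. L-lipschitz_on K G"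
    using locally_lipschitz_on_compact[OF locally_lipschitz_on_subset[OF G_locally_lipschitz assms(2)] assms(1)]
    by metis
  ultimately show "\<exists>L. L-lipschitz_on K F"
    unfolding F_def[abs_def] by (auto intro: lipschitz_on_add)
qed

text \<open>By the subgradient inequality, \<open>t\<close> is a local minimum of
  \<open>\<lambda>s. G (\<gamma> s) - w \<bullet> \<gamma> s\<close>, so the derivative of this
  function vanishes there.\<close>

lemma subgradient_chain_rule:
  assumes t: "t \<in> {0<..<1}" and dom: "\<And>s. s \<in> {0..1} \<Longrightarrow> \<gamma> s \<in> effective_domain g"
    and \<gamma>': "(\<gamma> has_vector_derivative \<gamma>') (at t)"
    and d: "((\<lambda>s. G (\<gamma> s)) has_real_derivative d) (at t)"
    and w: "w \<in> convex_subdifferential g (\<gamma> t)"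
  shows "d = w \<bullet> \<gamma>'"
proof -
  have "((\<lambda>s. w \<bullet> \<gamma> s) has_vector_derivative (w \<bullet> \<gamma>')) (at t)"
    by (rule bounded_linear.has_vector_derivative[OF bounded_linear_inner_right \<gamma>'])
  then have "((\<lambda>s. w \<bullet> \<gamma> s) has_real_derivative (w \<bullet> \<gamma>')) (at t)"
    by (simp add: has_real_derivative_iff_has_vector_derivative)
  then have der: "((\<lambda>s. G (\<gamma> s) - w \<bullet> \<gamma> s) has_real_derivative (d - w \<bullet> \<gamma>')) (at t)"
    by (rule DERIV_diff[OF d])
  have "d - w \<bullet> \<gamma>' = 0"
  proof (rule DERIV_local_min[OF der])
    show "0 < min t (1 - t)" using t by simp
    show "\<forall>y. \<bar>t - y\<bar> < min t (1 - t) \<longrightarrow> G (\<gamma> t) - w \<bullet> \<gamma> t \<le> G (\<gamma> y) - w \<bullet> \<gamma> y"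
    proof (intro allI impI)
      fix y assume "\<bar>t - y\<bar> < min t (1 - t)"
      then have "\<gamma> y \<in> effective_domain g" by (intro dom) auto
      then have "G (\<gamma> t) + w \<bullet> (\<gamma> y - \<gamma> t) \<le> G (\<gamma> y)"
        using w by (simp add: subdifferential_iff)
      then show "G (\<gamma> t) - w \<bullet> \<gamma> t \<le> G (\<gamma> y) - w \<bullet> \<gamma> y"
        by (simp add: inner_diff_right)
    qed
  qed
  then show ?thesis by simp
qed

text \<open>The chain rules hold for all elements of the fields, in particular for the components of
  \<open>u = - ((1 / T) *\<^sub>R \<gamma>')\<close>, which lies in the total field by
  \<open>incl\<close>. Adding them gives the derivative \<open>u \<bullet> \<gamma>'\<close>. The
  factor \<open>T\<close> comes from rescaling a curve of duration \<open>T\<close> to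
  [0,1].\<close>

lemma curve_chain_rule:
  assumes T: "T > 0" and \<gamma>: "L-lipschitz_on {0..1} \<gamma>"
    and dom: "\<And>s. s \<in> {0..1} \<Longrightarrow> \<gamma> s \<in> effective_domain g"
    and incl: "\<And>s \<gamma>'. s \<in> {0<..<1} \<Longrightarrow> (\<gamma> has_vector_derivative \<gamma>') (at s) \<Longrightarrow>
      - ((1 / T) *\<^sub>R \<gamma>') \<in> total_field N D g (\<gamma> s)"
  shows "AE t in lborel. t \<in> {0<..<1} \<longrightarrow> (\<exists>u\<in>total_field N D g (\<gamma> t).
    (\<gamma> has_vector_derivative (- (T *\<^sub>R u))) (at t) \<and>
    ((\<lambda>s. F (\<gamma> s)) has_real_derivative (- (T * (u \<bullet> u)))) (at t))"
proof -
  have "compact (\<gamma> ` {0..1})"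
    using lipschitz_on_continuous_on[OF \<gamma>] by (rule compact_continuous_image) simp
  moreover have "\<gamma> ` {0..1} \<subseteq> effective_domain g"
    using dom by (rule image_subsetI)
  ultimately obtain LG where LG: "LG-lipschitz_on (\<gamma> ` {0..1}) G"
    using F_lipschitz_on_compact(2) by blast
  have "(LG * L)-lipschitz_on {0..1} (\<lambda>s. G (\<gamma> s))"
    by (rule lipschitz_on_compose2[OF \<gamma> LG])
  then have AEG: "AE t in lborel. t \<in> {0<..<1} \<longrightarrow> (\<exists>d. ((\<lambda>s. G (\<gamma> s)) has_real_derivative d) (at t))"
    by (rule lipschitz_AE_differentiable)
  have ac: "abs_continuous_curve 0 1 \<gamma>" by (rule lipschitz_imp_abs_continuous_curve[OF \<gamma>])
  have AEf: "AE t in lborel. \<forall>i\<in>{1..N}. t \<in> {0..1} \<longrightarrow>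
      (\<exists>\<gamma>'. (\<gamma> has_vector_derivative \<gamma>') (at t within {0..1}) \<and>
        (\<forall>v\<in>D i (\<gamma> t). ((\<lambda>s. f i (\<gamma> s)) has_real_derivative (v \<bullet> \<gamma>')) (at t within {0..1})))"
  proof (rule AE_finite_allI)
    fix i assume "i \<in> {1..N}"
    from D_conservative[OF this] ac
    show "AE t in lborel. t \<in> {0..1} \<longrightarrow>
      (\<exists>\<gamma>'. (\<gamma> has_vector_derivative \<gamma>') (at t within {0..1}) \<and>
        (\<forall>v\<in>D i (\<gamma> t). ((\<lambda>s. f i (\<gamma> s)) has_real_derivative (v \<bullet> \<gamma>')) (at t within {0..1})))"
      unfolding conservative_field_def by blast
  qed simp
  show ?thesis
    using AEG AEf
  proof eventually_elim
    case (elim t)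
    show ?case
    proof
      assume t: "t \<in> {0<..<1}"
      then obtain d where d: "((\<lambda>s. G (\<gamma> s)) has_real_derivative d) (at t)" using elim(1) by blast
      have within: "at t within {0..1} = at t" using t by (simp add: at_within_Icc_at)
      have f: "\<exists>\<gamma>'. (\<gamma> has_vector_derivative \<gamma>') (at t) \<and>
          (\<forall>v\<in>D i (\<gamma> t). ((\<lambda>s. f i (\<gamma> s)) has_real_derivative (v \<bullet> \<gamma>')) (at t))" if "i \<in> {1..N}" for i
        using elim(2) that t unfolding within by simp
      obtain \<gamma>' where \<gamma>': "(\<gamma> has_vector_derivative \<gamma>') (at t)"
        using f[of 1] N_ge_1 by auto
      \<comment> \<open>Each conservative field provides a derivative of the curve of its own;
        uniqueness identifies all of them with \<open>\<gamma>'\<close>.\<close>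
      have fi: "((\<lambda>s. f i (\<gamma> s)) has_real_derivative (v \<bullet> \<gamma>')) (at t)"
        if i: "i \<in> {1..N}" and v: "v \<in> D i (\<gamma> t)" for i v
      proof -
        obtain \<gamma>'' where g2: "(\<gamma> has_vector_derivative \<gamma>'') (at t)"
          "((\<lambda>s. f i (\<gamma> s)) has_real_derivative (v \<bullet> \<gamma>'')) (at t)"
          using f[OF i] v by blast
        then show ?thesis using vector_derivative_unique_at[OF \<gamma>' g2(1)] by simp
      qed
      define u where "u = - ((1 / T) *\<^sub>R \<gamma>')"
      have u: "u \<in> total_field N D g (\<gamma> t)" unfolding u_def by (rule incl[OF t \<gamma>'])
      then obtain v w where v: "\<forall>i\<in>{1..N}. v i \<in> D i (\<gamma> t)" and w: "w \<in> convex_subdifferential g (\<gamma> t)"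
        and uvw: "u = (\<Sum>i=1..N. v i) + w"
        unfolding total_field_iff by blast
      have dw: "d = w \<bullet> \<gamma>'"
        by (rule subgradient_chain_rule[OF t dom \<gamma>' d w])
      have \<gamma>'u: "\<gamma>' = - (T *\<^sub>R u)" using T by (simp add: u_def)
      have "((\<lambda>s. F (\<gamma> s)) has_real_derivative ((\<Sum>i=1..N. v i \<bullet> \<gamma>') + w \<bullet> \<gamma>')) (at t)"
        unfolding F_def using fi v d dw by (intro DERIV_add DERIV_sum) auto
      also have "(\<Sum>i=1..N. v i \<bullet> \<gamma>') + w \<bullet> \<gamma>' = u \<bullet> \<gamma>'"
        by (simp add: uvw inner_add_left inner_sum_left)
      also have "\<dots> = - (T * (u \<bullet> u))" by (simp add: \<gamma>'u)
      finally have "((\<lambda>s. F (\<gamma> s)) has_real_derivative (- (T * (u \<bullet> u)))) (at t)" .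
      then show "\<exists>u\<in>total_field N D g (\<gamma> t). (\<gamma> has_vector_derivative (- (T *\<^sub>R u))) (at t) \<and>
          ((\<lambda>s. F (\<gamma> s)) has_real_derivative (- (T * (u \<bullet> u)))) (at t)"
        using u \<gamma>' unfolding \<gamma>'u by blast
    qed
  qed
qed

text \<open>In both cases \<open>F\<close> along the curve plus a comparison term is nonincreasing:
  since \<open>norm u\<close> is at least \<delta>, the rate of decrease
  \<open>T * (u \<bullet> u)\<close> dominates both \<open>T * \<delta>\<^sup>2\<close> and
  \<open>\<delta> * T * norm u\<close>.\<close>

lemma curve_descent:
  assumes T: "T > 0" and \<gamma>: "L-lipschitz_on {0..1} \<gamma>"
    and dom: "\<And>s. s \<in> {0..1} \<Longrightarrow> \<gamma> s \<in> effective_domain g"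
    and incl: "\<And>s \<gamma>'. s \<in> {0<..<1} \<Longrightarrow> (\<gamma> has_vector_derivative \<gamma>') (at s) \<Longrightarrow>
      - ((1 / T) *\<^sub>R \<gamma>') \<in> total_field N D g (\<gamma> s)"
    and \<delta>: "\<delta> > 0" "\<And>s u. s \<in> {0..1} \<Longrightarrow> u \<in> total_field N D g (\<gamma> s) \<Longrightarrow> \<delta> \<le> norm u"
  shows "F (\<gamma> 1) + T * \<delta>\<^sup>2 \<le> F (\<gamma> 0)" and "F (\<gamma> 1) + \<delta> * dist (\<gamma> 1) (\<gamma> 0) \<le> F (\<gamma> 0)"
proof -
  have "compact (\<gamma> ` {0..1})"
    using lipschitz_on_continuous_on[OF \<gamma>] by (rule compact_continuous_image) simp
  moreover have "\<gamma> ` {0..1} \<subseteq> effective_domain g"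
    using dom by (rule image_subsetI)
  ultimately obtain LF where LF: "LF-lipschitz_on (\<gamma> ` {0..1}) F"
    using F_lipschitz_on_compact(1) by blast
  have F\<gamma>: "(LF * L)-lipschitz_on {0..1} (\<lambda>s. F (\<gamma> s))"
    by (rule lipschitz_on_compose2[OF \<gamma> LF])
  have AE: "AE t in lborel. t \<in> {0<..<1} \<longrightarrow> (\<exists>u\<in>total_field N D g (\<gamma> t).
      (\<gamma> has_vector_derivative (- (T *\<^sub>R u))) (at t) \<and>
      ((\<lambda>s. F (\<gamma> s)) has_real_derivative (- (T * (u \<bullet> u)))) (at t))"
    by (rule curve_chain_rule[OF T \<gamma> dom incl])
  define h where "h = (\<lambda>s. F (\<gamma> s) + (T * \<delta>\<^sup>2) * s)"
  have "(LF * L + \<bar>T * \<delta>\<^sup>2\<bar> * 1)-lipschitz_on {0..1} h"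
    unfolding h_def by (intro lipschitz_on_add F\<gamma> lipschitz_on_cmult_real lipschitz_on_id)
  moreover have "AE t in lborel. t \<in> {0<..<1} \<longrightarrow> (\<exists>d\<le>0. (h has_real_derivative d) (at t))"
    using AE
  proof (rule AE_mp, intro AE_I2 impI)
    fix t :: real
    assume t: "t \<in> {0<..<1}" and "t \<in> {0<..<1} \<longrightarrow> (\<exists>u\<in>total_field N D g (\<gamma> t).
      (\<gamma> has_vector_derivative (- (T *\<^sub>R u))) (at t) \<and>
      ((\<lambda>s. F (\<gamma> s)) has_real_derivative (- (T * (u \<bullet> u)))) (at t))"
    then obtain u where u: "u \<in> total_field N D g (\<gamma> t)"
      "((\<lambda>s. F (\<gamma> s)) has_real_derivative (- (T * (u \<bullet> u)))) (at t)" by blast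
    have "(h has_real_derivative (- (T * (u \<bullet> u)) + T * \<delta>\<^sup>2)) (at t)"
      unfolding h_def by (auto intro!: derivative_eq_intros u(2))
    moreover have "\<delta>\<^sup>2 \<le> u \<bullet> u"
      using \<delta>(2)[OF _ u(1)] \<delta>(1) t by (simp add: power2_norm_eq_inner[symmetric] power_mono)
    then have "- (T * (u \<bullet> u)) + T * \<delta>\<^sup>2 \<le> 0" using T by simp
    ultimately show "\<exists>d\<le>0. (h has_real_derivative d) (at t)" by blast
  qed
  ultimately have "h 1 \<le> h 0" by (rule lipschitz_nonincreasing)
  then show "F (\<gamma> 1) + T * \<delta>\<^sup>2 \<le> F (\<gamma> 0)" by (simp add: h_def)
  \<comment> \<open>The inner product with the direction of the total displacement turns the
    distance of the endpoints into an increment of a scalar Lipschitz function. If the endpoints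
    coincide, \<open>sgn\<close> gives 0.\<close>
  define e where "e = sgn (\<gamma> 1 - \<gamma> 0)"
  define h where "h = (\<lambda>s. F (\<gamma> s) + \<delta> * (e \<bullet> \<gamma> s))"
  have e1: "norm e \<le> 1" by (simp add: e_def norm_sgn)
  have "L-lipschitz_on {0..1} (\<lambda>s. e \<bullet> \<gamma> s)"
  proof (rule lipschitz_onI)
    fix x y :: real assume xy: "x \<in> {0..1}" "y \<in> {0..1}"
    have "dist (e \<bullet> \<gamma> x) (e \<bullet> \<gamma> y) = \<bar>e \<bullet> (\<gamma> x - \<gamma> y)\<bar>"
      by (simp add: dist_real_def inner_diff_right)
    also have "\<dots> \<le> norm e * norm (\<gamma> x - \<gamma> y)" by (rule Cauchy_Schwarz_ineq2)
    also have "\<dots> \<le> 1 * norm (\<gamma> x - \<gamma> y)" using e1 by (intro mult_right_mono) auto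
    also have "\<dots> \<le> L * dist x y" using lipschitz_onD[OF \<gamma> xy] by (simp add: dist_norm)
    finally show "dist (e \<bullet> \<gamma> x) (e \<bullet> \<gamma> y) \<le> L * dist x y" .
  qed (rule lipschitz_on_nonneg[OF \<gamma>])
  then have "(LF * L + \<bar>\<delta>\<bar> * L)-lipschitz_on {0..1} h"
    unfolding h_def by (intro lipschitz_on_add F\<gamma> lipschitz_on_cmult_real)
  moreover have "AE t in lborel. t \<in> {0<..<1} \<longrightarrow> (\<exists>d\<le>0. (h has_real_derivative d) (at t))"
    using AE
  proof (rule AE_mp, intro AE_I2 impI)
    fix t :: real
    assume t: "t \<in> {0<..<1}" and "t \<in> {0<..<1} \<longrightarrow> (\<exists>u\<in>total_field N D g (\<gamma> t).
      (\<gamma> has_vector_derivative (- (T *\<^sub>R u))) (at t) \<and>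
      ((\<lambda>s. F (\<gamma> s)) has_real_derivative (- (T * (u \<bullet> u)))) (at t))"
    then obtain u where u: "u \<in> total_field N D g (\<gamma> t)" "(\<gamma> has_vector_derivative (- (T *\<^sub>R u))) (at t)"
      "((\<lambda>s. F (\<gamma> s)) has_real_derivative (- (T * (u \<bullet> u)))) (at t)" by blast
    have "((\<lambda>s. e \<bullet> \<gamma> s) has_vector_derivative (e \<bullet> (- (T *\<^sub>R u)))) (at t)"
      by (rule bounded_linear.has_vector_derivative[OF bounded_linear_inner_right u(2)])
    then have "((\<lambda>s. e \<bullet> \<gamma> s) has_real_derivative (- (T * (e \<bullet> u)))) (at t)"
      by (simp add: has_real_derivative_iff_has_vector_derivative)
    then have "(h has_real_derivative (- (T * (u \<bullet> u)) + \<delta> * (- (T * (e \<bullet> u))))) (at t)"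
      unfolding h_def by (intro DERIV_add u(3) DERIV_cmult)
    moreover have "- (T * (u \<bullet> u)) + \<delta> * (- (T * (e \<bullet> u))) \<le> 0"
    proof -
      have "- (e \<bullet> u) \<le> norm e * norm u" using Cauchy_Schwarz_ineq2[of e u] by linarith
      also have "\<dots> \<le> norm u" using e1 by (simp add: mult_left_le_one_le)
      finally have "\<delta> * (- (e \<bullet> u)) \<le> \<delta> * norm u" using \<delta>(1) by (intro mult_left_mono) auto
      also have "\<dots> \<le> norm u * norm u" using \<delta>(2)[OF _ u(1)] t by (intro mult_right_mono) auto
      also have "\<dots> = u \<bullet> u" by (simp add: power2_norm_eq_inner[symmetric] power2_eq_square)
      finally have "T * (\<delta> * (- (e \<bullet> u))) \<le> T * (u \<bullet> u)" using T by (intro mult_left_mono) auto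
      then show ?thesis by (simp add: algebra_simps)
    qed
    ultimately show "\<exists>d\<le>0. (h has_real_derivative d) (at t)" by blast
  qed
  ultimately have "h 1 \<le> h 0" by (rule lipschitz_nonincreasing)
  then have "F (\<gamma> 1) + \<delta> * (e \<bullet> (\<gamma> 1 - \<gamma> 0)) \<le> F (\<gamma> 0)"
    by (simp add: h_def inner_diff_right right_diff_distrib)
  moreover have "e \<bullet> (\<gamma> 1 - \<gamma> 0) = dist (\<gamma> 1) (\<gamma> 0)"
    by (cases "\<gamma> 1 = \<gamma> 0") (simp_all add: e_def sgn_div_norm dist_norm power2_norm_eq_inner[symmetric] power2_eq_square)
  ultimately show "F (\<gamma> 1) + \<delta> * dist (\<gamma> 1) (\<gamma> 0) \<le> F (\<gamma> 0)" by simp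
qed

section \<open>Passage to the limit\<close>

text \<open>The limits are taken in the order \<open>n\<close> to infinity, then \<open>s'\<close>
  to \<open>s\<close>, then \<rho> to 0. For fixed \<open>s'\<close> close to \<open>s\<close>,
  upper semicontinuity places the enlarged fields inside the \<rho>-neighborhood of the total field
  at \<open>\<gamma> s\<close>. This neighborhood is closed and convex, so it also contains the
  hulls, the limits of their elements and finally the derivative.\<close>

lemma limit_curve_inclusion:
  fixes \<gamma>s :: "nat \<Rightarrow> real \<Rightarrow> 'a"
  assumes lim: "\<And>s. s \<in> {0..1} \<Longrightarrow> (\<lambda>n. \<gamma>s n s) \<longlonglongrightarrow> \<gamma> s"
    and T: "T > 0" "Ts \<longlonglongrightarrow> T" and \<beta>: "\<beta> \<longlonglongrightarrow> 0"
    and B: "B > 0"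
    and hull: "\<And>n s s'. 0 \<le> s \<Longrightarrow> s < s' \<Longrightarrow> s' \<le> 1 \<Longrightarrow>
      (1 / (Ts n * (s' - s))) *\<^sub>R (\<gamma>s n s - \<gamma>s n s')
        \<in> convex hull (enlarged_field B (B * (2 * \<beta> n + Ts n * (s' - s))) (\<gamma>s n s))"
    and s: "s \<in> {0<..<1}" and \<gamma>': "(\<gamma> has_vector_derivative \<gamma>') (at s)"
  shows "- ((1 / T) *\<^sub>R \<gamma>') \<in> total_field N D g (\<gamma> s)"
proof -
  let ?F = "total_field N D g (\<gamma> s)"
  have near: "- ((1 / T) *\<^sub>R \<gamma>') \<in> ?F + cball 0 \<rho>" if \<rho>: "\<rho> > 0" for \<rho>
  proof -
    let ?A = "?F + cball 0 \<rho>"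
    have "?A = (\<Union>a\<in>?F. \<Union>b\<in>cball 0 \<rho>. {a + b})" by (auto simp: set_plus_def)
    then have clA: "closed ?A"
      using closed_compact_sums[OF closed_total_field compact_cball] by simp
    have cvA: "convex ?A" by (intro convex_set_plus convex_total_field convex_cball)
    obtain \<eta> where \<eta>: "\<eta> > 0" "enlarged_field B \<eta> (\<gamma> s) \<subseteq> ?A"
      using enlarged_field_upper_semicontinuous[OF \<rho>] by blast
    have quot: "(1 / (T * (s' - s))) *\<^sub>R (\<gamma> s - \<gamma> s') \<in> ?A"
      if s': "s < s'" "s' \<le> 1" "B * (T * (s' - s)) < \<eta>" for s'
    proof (rule Lim_in_closed_set[OF clA])
      show "(\<lambda>n. (1 / (Ts n * (s' - s))) *\<^sub>R (\<gamma>s n s - \<gamma>s n s'))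
          \<longlonglongrightarrow> (1 / (T * (s' - s))) *\<^sub>R (\<gamma> s - \<gamma> s')"
        using s s' T by (intro tendsto_intros lim) auto
      have "(\<lambda>n. B * (2 * \<beta> n + Ts n * (s' - s)) + dist (\<gamma>s n s) (\<gamma> s))
          \<longlonglongrightarrow> B * (2 * 0 + T * (s' - s)) + dist (\<gamma> s) (\<gamma> s)"
        using s by (intro tendsto_intros lim T \<beta>) auto
      then have "\<forall>\<^sub>F n in sequentially. B * (2 * \<beta> n + Ts n * (s' - s)) + dist (\<gamma>s n s) (\<gamma> s) < \<eta>"
        by (rule order_tendstoD(2)) (use s' in simp)
      then show "\<forall>\<^sub>F n in sequentially. (1 / (Ts n * (s' - s))) *\<^sub>R (\<gamma>s n s - \<gamma>s n s') \<in> ?A"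
      proof eventually_elim
        case (elim n)
        have "enlarged_field B (B * (2 * \<beta> n + Ts n * (s' - s))) (\<gamma>s n s) \<subseteq> enlarged_field B \<eta> (\<gamma> s)"
          by (rule enlarged_field_mono) (use elim in simp)
        also have "\<dots> \<subseteq> ?A" by (rule \<eta>(2))
        finally have "convex hull (enlarged_field B (B * (2 * \<beta> n + Ts n * (s' - s))) (\<gamma>s n s)) \<subseteq> ?A"
          using cvA by (rule hull_minimal)
        then show ?case using hull[of s s' n] s s' by auto
      qed
    qed simp
    have "\<exists>y\<in>?A. dist y (- ((1 / T) *\<^sub>R \<gamma>')) < e" if e: "e > 0" for e
    proof -
      have "(\<gamma> has_derivative (\<lambda>x. x *\<^sub>R \<gamma>')) (at s)"
        using \<gamma>' by (simp add: has_vector_derivative_def)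
      \<comment> \<open>The factor \<open>T\<close> cancels the \<open>1 / T\<close> in the rescaled
        quotient, and the half makes the final estimate strict.\<close>
      moreover have "e * T / 2 > 0" using e T by simp
      ultimately obtain d where d: "d > 0"
        "\<And>y. norm (y - s) < d \<Longrightarrow> norm (\<gamma> y - \<gamma> s - (y - s) *\<^sub>R \<gamma>') \<le> e * T / 2 * norm (y - s)"
        unfolding has_derivative_at_alt by blast
      \<comment> \<open>The three bounds serve the derivative estimate, the requirement
        \<open>s + r \<le> 1\<close> and the condition \<open>B * (T * r) < \<eta>\<close> of
        \<open>quot\<close>.\<close>
      define r where "r = min (d / 2) (min (1 - s) (\<eta> / (2 * B * T)))"
      have r: "r > 0" "r < d" "s + r \<le> 1" using d(1) s \<eta>(1) B T by (auto simp: r_def)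
      have "B * (T * r) \<le> B * (T * (\<eta> / (2 * B * T)))"
        using B T by (intro mult_left_mono) (auto simp: r_def)
      also have "\<dots> < \<eta>" using B T \<eta>(1) by simp
      finally have r': "B * (T * r) < \<eta>" .
      define q where "q = (1 / (T * r)) *\<^sub>R (\<gamma> s - \<gamma> (s + r))"
      have "q \<in> ?A" using quot[of "s + r"] r r' by (simp add: q_def)
      moreover have "dist q (- ((1 / T) *\<^sub>R \<gamma>')) < e"
      proof -
        have "q - (- ((1 / T) *\<^sub>R \<gamma>')) = - ((1 / (T * r)) *\<^sub>R (\<gamma> (s + r) - \<gamma> s - r *\<^sub>R \<gamma>'))"
          using r(1) T by (simp add: q_def algebra_simps)
        then have "dist q (- ((1 / T) *\<^sub>R \<gamma>')) = (1 / (T * r)) * norm (\<gamma> (s + r) - \<gamma> s - r *\<^sub>R \<gamma>')"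
          using r(1) T unfolding dist_norm by (simp add: norm_scaleR del: scaleR_diff_right)
        also have "\<dots> \<le> (1 / (T * r)) * (e * T / 2 * r)"
          using d(2)[of "s + r"] r T by (intro mult_left_mono) auto
        also have "\<dots> < e" using r(1) T e by simp
        finally show ?thesis .
      qed
      ultimately show ?thesis by blast
    qed
    then have "- ((1 / T) *\<^sub>R \<gamma>') \<in> closure ?A" unfolding closure_approachable by blast
    then show ?thesis unfolding closure_closed[OF clA] .
  qed
  have "\<exists>y\<in>?F. dist y (- ((1 / T) *\<^sub>R \<gamma>')) < e" if e: "e > 0" for e
  proof -
    obtain a b where "a \<in> ?F" "b \<in> cball 0 (e / 2)" "- ((1 / T) *\<^sub>R \<gamma>') = a + b"
      using near[of "e / 2"] e by (auto simp: set_plus_def)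
    then show ?thesis using e by (intro bexI[of _ a]) (auto simp: dist_norm)
  qed
  then have "- ((1 / T) *\<^sub>R \<gamma>') \<in> closure ?F" unfolding closure_approachable by blast
  then show ?thesis unfolding closure_closed[OF closed_total_field] .
qed

text \<open>This bundles the conclusions of \<open>interpolated_curve\<close>, so that a whole
  sequence of curves with these properties can be chosen at once.\<close>

definition interpolant ::
    "real \<Rightarrow> real \<Rightarrow> real \<Rightarrow> real \<Rightarrow> (nat \<Rightarrow> 'a) \<Rightarrow> real \<Rightarrow> (real \<Rightarrow> 'a) \<Rightarrow> bool" where
  "interpolant \<tau> \<rho> B \<beta> x T \<gamma> \<longleftrightarrow>
    min \<tau> (\<rho> / B) \<le> T \<and> T \<le> \<tau> + \<beta> \<and> \<gamma> 0 = x 0 \<and> (B * T)-lipschitz_on {0..1} \<gamma> \<and>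
    (\<tau> \<le> T \<or> \<rho> \<le> dist (\<gamma> 1) (\<gamma> 0)) \<and>
    (\<forall>s\<in>{0..1}. \<exists>k. dist (x k) (\<gamma> s) \<le> B * \<beta>) \<and>
    (\<forall>s s'. 0 \<le> s \<longrightarrow> s < s' \<longrightarrow> s' \<le> 1 \<longrightarrow>
      (1 / (T * (s' - s))) *\<^sub>R (\<gamma> s - \<gamma> s')
        \<in> convex hull (enlarged_field B (B * (2 * \<beta> + T * (s' - s))) (\<gamma> s)))"

text \<open>Until the iterates leave the ball of radius \<rho> about the start, their norm is at
  most \<open>R + \<rho>\<close>, and \<open>prr_step\<close> applies on that ball. One
  \<open>B\<close> works for all sequences, which makes the later curves equi-Lipschitz.\<close>

lemma prr_interpolation:
  assumes X0: "X0 \<subseteq> effective_domain g" "\<And>p. p \<in> X0 \<Longrightarrow> norm p \<le> R"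
    and pos: "\<tau> > 0" "\<rho> > 0"
  obtains B where "B > 0"
    "\<And>\<alpha> x \<beta>. \<lbrakk>prr_sequence N f D g \<alpha> x; x 0 \<in> X0; \<And>k. \<alpha> k \<le> \<beta>; B * \<beta> \<le> 1;
      filterlim (\<lambda>n. \<Sum>k<n. \<alpha> k) at_top sequentially\<rbrakk> \<Longrightarrow>
      (\<forall>k. x k \<in> effective_domain g) \<and>
      (\<exists>T \<gamma>. interpolant \<tau> \<rho> B \<beta> x T \<gamma>)"
proof -
  obtain B where B: "B > 0"
    "\<And>\<alpha> x y z \<sigma>. \<lbrakk>x \<in> effective_domain g; norm x \<le> R + \<rho>; 0 < \<alpha>; B * \<alpha> \<le> 1; \<sigma> permutes {1..N}; y 0 = x;
      \<forall>i\<in>{1..N}. y i \<in> (\<lambda>v. y (i - 1) - \<alpha> *\<^sub>R v) ` D (\<sigma> i) (y (i - 1));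
      z \<in> prox (\<lambda>z. ereal \<alpha> * g z) (y N)\<rbrakk> \<Longrightarrow>
      z \<in> effective_domain g \<and> dist x z \<le> B * \<alpha> \<and> (1 / \<alpha>) *\<^sub>R (x - z) \<in> enlarged_field B (B * \<alpha>) x"
    using prr_step[of "R + \<rho>"] by blast
  show thesis
  proof (rule that[OF B(1)])
    fix \<alpha> :: "nat \<Rightarrow> real" and x :: "nat \<Rightarrow> 'a" and \<beta> :: real
    assume prr: "prr_sequence N f D g \<alpha> x" and x0: "x 0 \<in> X0" and \<alpha>\<beta>: "\<And>k. \<alpha> k \<le> \<beta>" and \<beta>: "B * \<beta> \<le> 1"
      and div: "filterlim (\<lambda>n. \<Sum>k<n. \<alpha> k) at_top sequentially"
    from prr have \<alpha>0: "\<And>k. \<alpha> k > 0" by (simp add: prr_sequence_def)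
    from prr obtain \<sigma> y where y: "\<And>k. \<sigma> k permutes {1..N}" "\<And>k. y k 0 = x k"
      "\<And>k. \<forall>i\<in>{1..N}. y k i \<in> (\<lambda>v. y k (i - 1) - \<alpha> k *\<^sub>R v) ` D (\<sigma> k i) (y k (i - 1))"
      "\<And>k. x (Suc k) \<in> prox (\<lambda>z. ereal (\<alpha> k) * g z) (y k N)"
      unfolding prr_sequence_def by blast
    have dom: "x k \<in> effective_domain g" for k
    proof (cases k)
      case (Suc j)
      then show ?thesis
        using prox_subgradient[OF \<alpha>0 y(4)[of j]] by (simp add: subdifferential_iff)
    qed (use x0 X0 in auto)
    have \<alpha>B: "B * \<alpha> k \<le> B * \<beta>" for k using \<alpha>\<beta> B(1) by simp
    have step: "dist (x k) (x (Suc k)) \<le> B * \<alpha> k \<and>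
        (1 / \<alpha> k) *\<^sub>R (x k - x (Suc k)) \<in> enlarged_field B (B * \<beta>) (x k)" if "dist (x k) (x 0) < \<rho>" for k
    proof -
      have "norm (x k) \<le> norm (x k - x 0) + norm (x 0)"
        using norm_triangle_ineq[of "x k - x 0" "x 0"] by simp
      then have "norm (x k) \<le> R + \<rho>" using that X0(2)[OF x0] by (simp add: dist_norm)
      moreover have "B * \<alpha> k \<le> 1" using \<alpha>B[of k] \<beta> by linarith
      ultimately have "dist (x k) (x (Suc k)) \<le> B * \<alpha> k \<and>
        (1 / \<alpha> k) *\<^sub>R (x k - x (Suc k)) \<in> enlarged_field B (B * \<alpha> k) (x k)"
        using B(2)[OF dom _ \<alpha>0 _ y(1) y(2) y(3) y(4)] by blast
      moreover have "enlarged_field B (B * \<alpha> k) (x k) \<subseteq> enlarged_field B (B * \<beta>) (x k)"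
        by (rule enlarged_field_mono) (use \<alpha>B in simp)
      ultimately show ?thesis by blast
    qed
    show "(\<forall>k. x k \<in> effective_domain g) \<and>
      (\<exists>T \<gamma>. interpolant \<tau> \<rho> B \<beta> x T \<gamma>)"
      (is "_ \<and> ?ex")
    proof
      show ?ex
      proof (rule interpolated_curve[of \<alpha> \<beta> \<tau> \<rho> B "enlarged_field B" x])
        fix T \<gamma>
        assume "min \<tau> (\<rho> / B) \<le> T" "T \<le> \<tau> + \<beta>" "\<gamma> 0 = x 0" "(B * T)-lipschitz_on {0..1} \<gamma>"
          "\<tau> \<le> T \<or> \<rho> \<le> dist (\<gamma> 1) (\<gamma> 0)"
          "\<And>s. s \<in> {0..1} \<Longrightarrow> \<exists>k. dist (x k) (\<gamma> s) \<le> B * \<beta>"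
          "\<And>s s'. 0 \<le> s \<Longrightarrow> s < s' \<Longrightarrow> s' \<le> 1 \<Longrightarrow> (1 / (T * (s' - s))) *\<^sub>R (\<gamma> s - \<gamma> s')
            \<in> convex hull (enlarged_field B (B * (2 * \<beta> + T * (s' - s))) (\<gamma> s))"
        then have "interpolant \<tau> \<rho> B \<beta> x T \<gamma>"
          unfolding interpolant_def by (intro conjI ballI allI impI)
        then show ?ex by blast
      qed (use \<alpha>0 \<alpha>\<beta> div pos B(1) enlarged_field_mono step in blast)+
    qed (use dom in blast)
  qed
qed

section \<open>From the limit curve to the contradiction\<close>

lemma effective_domain_total_objective:
  "effective_domain (total_objective N f g) = effective_domain g"
  by (auto simp: effective_domain_def total_objective_def)

lemma total_objective_eq_F: "x \<in> effective_domain g \<Longrightarrow> total_objective N f g x = ereal (F x)"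
  using g_eq_G by (simp add: total_objective_def F_def)

lemma not_near_approx_stationary_norm:
  assumes "\<not> near_approx_stationary \<epsilon> \<delta> (total_field N D g) x"
    and "dist x p \<le> \<epsilon>" "u \<in> total_field N D g p"
  shows "\<delta> < norm u"
proof -
  have "dist_to_set 0 (\<Union> (total_field N D g ` cball x \<epsilon>)) \<le> ereal (dist 0 u)"
    unfolding dist_to_set_def using assms(2,3) by (intro INF_lower) auto
  then have "ereal \<delta> < ereal (dist 0 u)"
    using assms(1) unfolding near_approx_stationary_def by (meson less_le_trans not_le)
  then show ?thesis by simp
qed

text \<open>The order of choices matters: \<tau> and \<rho> depend only on \<delta> and the bounds
  for the objective, then \<open>prr_interpolation\<close> supplies \<open>B\<close>, and only
  afterwards are the step size bounds \<open>\<beta> n\<close> fixed.\<close>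

lemma prr_reaches_near_stationary:
  assumes below: "\<And>x. x \<in> effective_domain g \<Longrightarrow> m \<le> F x"
    and \<delta>: "\<delta> > 0" and \<epsilon>: "\<epsilon> > 0"
    and X0: "bounded X0" "X0 \<subseteq> effective_domain g"
  shows "\<exists>\<alpha>bar>0. \<forall>(\<alpha> :: nat \<Rightarrow> real) (x :: nat \<Rightarrow> 'a).
    prr_sequence N f D g \<alpha> x \<longrightarrow> x 0 \<in> X0 \<longrightarrow> (\<forall>k. \<alpha> k \<in> {0<..\<alpha>bar}) \<longrightarrow>
    filterlim (\<lambda>n. \<Sum>k<n. \<alpha> k) at_top sequentially \<longrightarrow>
    (\<exists>k. near_approx_stationary \<epsilon> \<delta> (total_field N D g) (x k))"
proof (rule ccontr)
  assume neg: "\<not> ?thesis"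
  obtain R where R: "\<And>p. p \<in> X0 \<Longrightarrow> norm p \<le> R"
    using X0(1) by (auto simp: bounded_iff)
  \<comment> \<open>The limit curve will start in the closure of \<open>X0\<close>, so an upper
    bound for \<open>F\<close> is needed on the closure.\<close>
  have K: "compact (closure X0)" "closure X0 \<subseteq> effective_domain g"
    using X0 closure_minimal[OF X0(2) g_dom_closed] by (auto simp: compact_closure)
  obtain LF where "LF-lipschitz_on (closure X0) F"
    using F_lipschitz_on_compact(1)[OF K] by blast
  then have "bounded (F ` closure X0)"
    by (intro compact_imp_bounded compact_continuous_image[OF lipschitz_on_continuous_on K(1)])
  then obtain M where M: "\<And>p. p \<in> closure X0 \<Longrightarrow> F p \<le> M"
    unfolding bounded_iff by (metis abs_le_D1 imageI real_norm_def)
  \<comment> \<open>The absolute value keeps \<Delta> nonnegative even for empty \<open>X0\<close>,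
    where \<open>M\<close> is arbitrary. The summands 1 in \<tau> and \<rho> make the final
    inequalities strict.\<close>
  define \<Delta> where "\<Delta> = \<bar>M - m\<bar>"
  define \<tau> where "\<tau> = \<Delta> / \<delta>\<^sup>2 + 1"
  define \<rho> where "\<rho> = \<Delta> / \<delta> + 1"
  have \<Delta>0: "\<Delta> \<ge> 0" by (simp add: \<Delta>_def)
  have pos: "\<tau> > 0" "\<rho> > 0"
    using \<Delta>0 \<delta> by (auto simp: \<tau>_def \<rho>_def intro: add_nonneg_pos)
  obtain B where B: "B > 0"
    and interp: "\<And>\<alpha> x \<beta>. \<lbrakk>prr_sequence N f D g \<alpha> x; x 0 \<in> X0; \<And>k. \<alpha> k \<le> \<beta>; B * \<beta> \<le> 1;
      filterlim (\<lambda>n. \<Sum>k<n. \<alpha> k) at_top sequentially\<rbrakk> \<Longrightarrow>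
      (\<forall>k. x k \<in> effective_domain g) \<and>
      (\<exists>T \<gamma>. interpolant \<tau> \<rho> B \<beta> x T \<gamma>)"
    using prr_interpolation[OF X0(2) R pos] by blast
  \<comment> \<open>The bounds tend to 0, and \<open>B * \<beta> n = 1 / (n + 1)\<close> meets the
    requirement \<open>B * \<beta> \<le> 1\<close> of \<open>interp\<close>.\<close>
  define \<beta> where "\<beta> = (\<lambda>n. 1 / (B * real (Suc n)))"
  have \<beta>0: "\<beta> n > 0" for n using B by (simp add: \<beta>_def)
  have B\<beta>: "B * \<beta> n = 1 / real (Suc n)" for n using B by (simp add: \<beta>_def)
  have B\<beta>1: "B * \<beta> n \<le> 1" for n unfolding B\<beta> by simp
  have \<beta>1: "\<beta> n \<le> 1 / B" for n
    using B\<beta>1[of n] B by (simp add: field_simps)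
  have B\<beta>lim: "(\<lambda>n. B * \<beta> n) \<longlonglongrightarrow> 0"
    unfolding B\<beta> using LIMSEQ_inverse_real_of_nat by (simp add: inverse_eq_divide)
  have \<beta>lim: "\<beta> \<longlonglongrightarrow> 0"
    using tendsto_mult_left[OF B\<beta>lim, of "1 / B"] B by simp
  have "\<exists>x T \<gamma>. x 0 \<in> X0 \<and> (\<forall>k. x k \<in> effective_domain g) \<and>
      (\<forall>k. \<not> near_approx_stationary \<epsilon> \<delta> (total_field N D g) (x k)) \<and>
      interpolant \<tau> \<rho> B (\<beta> n) x T \<gamma>"
    (is "\<exists>x T \<gamma>. ?P n x T \<gamma>") for n
  proof -
    obtain \<alpha> x where x: "prr_sequence N f D g \<alpha> x" "x 0 \<in> X0" "\<And>k. \<alpha> k \<in> {0<..\<beta> n}"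
      "filterlim (\<lambda>n. \<Sum>k<n. \<alpha> k) at_top sequentially"
      "\<not> (\<exists>k. near_approx_stationary \<epsilon> \<delta> (total_field N D g) (x k))"
      using neg \<beta>0[of n] by meson
    have "\<alpha> k \<le> \<beta> n" for k using x(3)[of k] by simp
    from interp[OF x(1,2) this B\<beta>1 x(4)] x(2,5)
    show ?thesis by blast
  qed
  then obtain x T \<gamma> where "\<And>n. ?P n (x n) (T n) (\<gamma> n)" by metis
  then have x0: "\<And>n. x n 0 \<in> X0" and dom: "\<And>n k. x n k \<in> effective_domain g"
    and away: "\<And>n k. \<not> near_approx_stationary \<epsilon> \<delta> (total_field N D g) (x n k)"
    and T: "\<And>n. min \<tau> (\<rho> / B) \<le> T n" "\<And>n. T n \<le> \<tau> + \<beta> n" and \<gamma>0: "\<And>n. \<gamma> n 0 = x n 0"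
    and lip: "\<And>n. (B * T n)-lipschitz_on {0..1} (\<gamma> n)"
    and exit: "\<And>n. \<tau> \<le> T n \<or> \<rho> \<le> dist (\<gamma> n 1) (\<gamma> n 0)"
    and near: "\<And>n s. s \<in> {0..1} \<Longrightarrow> \<exists>k. dist (x n k) (\<gamma> n s) \<le> B * \<beta> n"
    and hull: "\<And>n s s'. 0 \<le> s \<Longrightarrow> s < s' \<Longrightarrow> s' \<le> 1 \<Longrightarrow>
      (1 / (T n * (s' - s))) *\<^sub>R (\<gamma> n s - \<gamma> n s')
        \<in> convex hull (enlarged_field B (B * (2 * \<beta> n + T n * (s' - s))) (\<gamma> n s))"
    unfolding interpolant_def by blast+
  \<comment> \<open>Because \<open>\<beta> n\<close> is at most \<open>1 / B\<close>, all durations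
    are at most \<open>\<tau> + 1 / B\<close>, which gives a Lipschitz constant common to all
    curves.\<close>
  define C where "C = B * (\<tau> + 1 / B)"
  have C: "C-lipschitz_on {0..1} (\<gamma> n)" for n
  proof (rule lipschitz_on_le[OF lip])
    have "T n \<le> \<tau> + 1 / B" using T(2)[of n] \<beta>1[of n] by linarith
    then show "B * T n \<le> C" unfolding C_def using B by simp
  qed
  have C0: "C > 0" using B pos by (simp add: C_def add_pos_pos)
  obtain \<Gamma> q where q: "strict_mono (q :: nat \<Rightarrow> nat)"
    and unif: "\<And>e. 0 < e \<Longrightarrow> \<exists>N. \<forall>n s. n \<ge> N \<and> s \<in> {0..1} \<longrightarrow> norm (\<gamma> (q n) s - \<Gamma> s) < e"
  proof (rule Arzela_Ascoli[of "{0..1::real}" \<gamma> "R + C"])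
    show "norm (\<gamma> n s) \<le> R + C" if "s \<in> {0..1}" for n s
    proof -
      have "dist (\<gamma> n s) (\<gamma> n 0) \<le> C * dist s 0"
        by (rule lipschitz_onD[OF C]) (use that in auto)
      also have "\<dots> \<le> C * 1" using that C0 by (intro mult_left_mono) auto
      finally have "norm (\<gamma> n s - \<gamma> n 0) \<le> C" by (simp add: dist_norm)
      moreover have "norm (\<gamma> n 0) \<le> R" using R x0 \<gamma>0 by simp
      ultimately show ?thesis using norm_triangle_ineq[of "\<gamma> n s - \<gamma> n 0" "\<gamma> n 0"] by simp
    qed
    show "\<exists>d>0. \<forall>n t. t \<in> {0..1} \<and> norm (s - t) < d \<longrightarrow> norm (\<gamma> n s - \<gamma> n t) < e"
      if "s \<in> {0..1}" "0 < e" for s e :: real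
    proof (intro exI[of _ "e / C"] conjI allI impI)
      fix n and t :: real assume t: "t \<in> {0..1} \<and> norm (s - t) < e / C"
      have "norm (\<gamma> n s - \<gamma> n t) \<le> C * norm (s - t)"
        using lipschitz_onD[OF C that(1), of t n] t by (simp add: dist_norm)
      also have "\<dots> < C * (e / C)" using t C0 by (intro mult_strict_left_mono) auto
      also have "\<dots> = e" using C0 by simp
      finally show "norm (\<gamma> n s - \<gamma> n t) < e" .
    qed (use that C0 in simp)
  qed auto
  \<comment> \<open>The curves converge along \<open>q\<close>; a further subsequence makes the
    durations converge as well.\<close>
  have "bounded (range (T \<circ> q))"
    unfolding bounded_iff
  proof (intro exI[of _ "\<tau> + 1 / B"] ballI)
    fix t assume "t \<in> range (T \<circ> q)"
    then obtain n where "t = T n" by auto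
    moreover have "0 < T n" using T(1)[of n] pos B by (auto simp: min_def split: if_splits intro: less_le_trans[rotated])
    ultimately show "norm t \<le> \<tau> + 1 / B" using T(2)[of n] \<beta>1[of n] by simp
  qed
  then obtain T' r where r: "strict_mono (r :: nat \<Rightarrow> nat)" "((T \<circ> q) \<circ> r) \<longlonglongrightarrow> T'"
    using bounded_imp_convergent_subsequence by blast
  define p where "p = q \<circ> r"
  have p: "strict_mono p" unfolding p_def by (rule strict_mono_o[OF q r(1)])
  have Tlim: "(\<lambda>n. T (p n)) \<longlonglongrightarrow> T'" using r(2) by (simp add: p_def o_def)
  have lim: "(\<lambda>n. \<gamma> (p n) s) \<longlonglongrightarrow> \<Gamma> s" if "s \<in> {0..1}" for s
  proof -
    have "(\<lambda>n. \<gamma> (q n) s) \<longlonglongrightarrow> \<Gamma> s"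
      unfolding LIMSEQ_iff using unif that by blast
    from LIMSEQ_subseq_LIMSEQ[OF this r(1)] show ?thesis by (simp add: p_def o_def)
  qed
  have \<beta>p: "(\<lambda>n. \<beta> (p n)) \<longlonglongrightarrow> 0" "(\<lambda>n. B * \<beta> (p n)) \<longlonglongrightarrow> 0"
    using LIMSEQ_subseq_LIMSEQ[OF \<beta>lim p] LIMSEQ_subseq_LIMSEQ[OF B\<beta>lim p] by (simp_all add: o_def)
  have "min \<tau> (\<rho> / B) \<le> T'"
    by (rule LIMSEQ_le_const[OF Tlim]) (use T(1) in blast)
  then have T': "T' > 0" using pos B by (auto simp: min_def split: if_splits intro: less_le_trans[rotated])
  have lip': "C-lipschitz_on {0..1} \<Gamma>"
  proof (rule lipschitz_onI)
    fix s t :: real assume st: "s \<in> {0..1}" "t \<in> {0..1}"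
    have "(\<lambda>n. dist (\<gamma> (p n) s) (\<gamma> (p n) t)) \<longlonglongrightarrow> dist (\<Gamma> s) (\<Gamma> t)"
      by (intro tendsto_dist lim st)
    then show "dist (\<Gamma> s) (\<Gamma> t) \<le> C * dist s t"
      by (rule LIMSEQ_le_const2) (use lipschitz_onD[OF C st] in blast)
  qed (use C0 in simp)
  \<comment> \<open>Points of the limit curve are limits of actual iterates, which transfers to the
    curve both membership in the domain and the failure of near stationarity.\<close>
  have near': "\<exists>k. (\<lambda>n. x (p n) (k n)) \<longlonglongrightarrow> \<Gamma> s" if s: "s \<in> {0..1}" for s
  proof -
    from near[OF s] obtain k where k: "\<And>n. dist (x n (k n)) (\<gamma> n s) \<le> B * \<beta> n" by metis
    have "(\<lambda>n. dist (x (p n) (k (p n))) (\<gamma> (p n) s)) \<longlonglongrightarrow> 0"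
      by (rule tendsto_sandwich[OF _ _ tendsto_const \<beta>p(2)]) (use k in auto)
    then have "(\<lambda>n. x (p n) (k (p n)) - \<gamma> (p n) s) \<longlonglongrightarrow> 0"
      by (simp add: dist_norm tendsto_norm_zero_iff)
    from tendsto_add[OF this lim[OF s]] show ?thesis by auto
  qed
  have dom': "\<Gamma> s \<in> effective_domain g" if s: "s \<in> {0..1}" for s
  proof -
    obtain k where k: "(\<lambda>n. x (p n) (k n)) \<longlonglongrightarrow> \<Gamma> s" using near'[OF s] by blast
    show ?thesis by (rule closed_sequentially[OF g_dom_closed _ k]) (rule dom)
  qed
  have incl: "- ((1 / T') *\<^sub>R \<gamma>') \<in> total_field N D g (\<Gamma> s)"
    if "s \<in> {0<..<1}" "(\<Gamma> has_vector_derivative \<gamma>') (at s)" for s \<gamma>'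
    by (rule limit_curve_inclusion[where \<gamma>s = "\<lambda>n. \<gamma> (p n)" and Ts = "\<lambda>n. T (p n)" and \<beta> = "\<lambda>n. \<beta> (p n)"
          and B = B, OF lim T' Tlim \<beta>p(1) B hull that])
  \<comment> \<open>Some iterate lies within \<epsilon> of \<open>\<Gamma> s\<close>, so its
    \<epsilon>-ball contains \<open>\<Gamma> s\<close> and hence sees every element of the field
    there.\<close>
  have away': "\<delta> \<le> norm u" if s: "s \<in> {0..1}" and u: "u \<in> total_field N D g (\<Gamma> s)" for s u
  proof -
    obtain k where "(\<lambda>n. x (p n) (k n)) \<longlonglongrightarrow> \<Gamma> s" using near'[OF s] by blast
    from tendstoD[OF this \<epsilon>] obtain n where "dist (x (p n) (k n)) (\<Gamma> s) < \<epsilon>"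
      by (auto simp: eventually_sequentially)
    then show ?thesis
      using not_near_approx_stationary_norm[OF away _ u] by (meson less_imp_le)
  qed
  have descent: "F (\<Gamma> 1) + T' * \<delta>\<^sup>2 \<le> F (\<Gamma> 0)" "F (\<Gamma> 1) + \<delta> * dist (\<Gamma> 1) (\<Gamma> 0) \<le> F (\<Gamma> 0)"
    by (rule curve_descent[OF T' lip' dom' incl \<delta> away']; assumption)+
  have "(\<lambda>n. x (p n) 0) \<longlonglongrightarrow> \<Gamma> 0" using lim[of 0] by (simp add: \<gamma>0)
  then have "\<Gamma> 0 \<in> closure X0"
    using x0 by (meson closure_sequential)
  then have "F (\<Gamma> 0) \<le> M" by (rule M)
  moreover have "m \<le> F (\<Gamma> 1)" by (intro below dom') simp
  ultimately have "F (\<Gamma> 0) - F (\<Gamma> 1) \<le> \<Delta>" by (simp add: \<Delta>_def)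
  then have bounds: "T' * \<delta>\<^sup>2 \<le> \<Delta>" "\<delta> * dist (\<Gamma> 1) (\<Gamma> 0) \<le> \<Delta>"
    using descent by linarith+
  have "\<tau> * \<delta>\<^sup>2 = \<Delta> + \<delta>\<^sup>2" using \<delta> by (simp add: \<tau>_def distrib_right)
  then have "T' * \<delta>\<^sup>2 < \<tau> * \<delta>\<^sup>2"
    using bounds(1) zero_less_power[OF \<delta>, of 2] by linarith
  then have "T' < \<tau>" using \<delta> by (simp add: mult_less_cancel_right)
  have "\<delta> * dist (\<Gamma> 1) (\<Gamma> 0) < \<delta> * \<rho>"
    using bounds(2) \<delta> by (simp add: \<rho>_def algebra_simps)
  then have "dist (\<Gamma> 1) (\<Gamma> 0) < \<rho>" using \<delta> by simp
  moreover have "(\<lambda>n. dist (\<gamma> (p n) 1) (\<gamma> (p n) 0)) \<longlonglongrightarrow> dist (\<Gamma> 1) (\<Gamma> 0)"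
    by (intro tendsto_dist lim) auto
  ultimately have "\<forall>\<^sub>F n in sequentially. dist (\<gamma> (p n) 1) (\<gamma> (p n) 0) < \<rho>"
    by (intro order_tendstoD(2))
  moreover have "\<forall>\<^sub>F n in sequentially. T (p n) < \<tau>"
    using Tlim \<open>T' < \<tau>\<close> by (rule order_tendstoD(2))
  \<comment> \<open>Every curve stopped for one of the two reasons in \<open>exit\<close>, but along
    the subsequence both are eventually violated.\<close>
  ultimately have "\<forall>\<^sub>F n :: nat in sequentially. False"
    by eventually_elim (use exit in \<open>force simp: not_le[symmetric]\<close>)
  then show False by simp
qed

end

theorem theorem3p8:
  fixes N :: nat
    and f :: "nat \<Rightarrow> 'a::euclidean_space \<Rightarrow> real"
    and D :: "nat \<Rightarrow> 'a \<Rightarrow> 'a set"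
    and g :: "'a \<Rightarrow> ereal"
    and \<epsilon> \<delta> :: real
    and X0 :: "'a set"
  assumes "N \<ge> 1"
    and "\<And>i. i \<in> {1..N} \<Longrightarrow> locally_lipschitz_on UNIV (f i)"
    and "\<And>i. i \<in> {1..N} \<Longrightarrow> conservative_field (D i) (f i)"
    and "\<And>i. i \<in> {1..N} \<Longrightarrow> locally_bounded_map (D i)"
    and "\<And>i x. i \<in> {1..N} \<Longrightarrow> D i x \<noteq> {} \<and> convex (D i x)"
    and "proper_ereal g"
    and "convex_ereal g"
    and "closed (effective_domain g)"
    and "locally_lipschitz_on (effective_domain g) (\<lambda>x. real_of_ereal (g x))"
    and "\<exists>m::real. \<forall>x. ereal m \<le> total_objective N f g x"
    and "\<delta> > 0" and "\<epsilon> > 0"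
    and "bounded X0" and "X0 \<subseteq> effective_domain (total_objective N f g)"
  shows "\<exists>\<alpha>bar>0. \<forall>(\<alpha> :: nat \<Rightarrow> real) (x :: nat \<Rightarrow> 'a).
           prr_sequence N f D g \<alpha> x \<longrightarrow> x 0 \<in> X0 \<longrightarrow>
           (\<forall>k. \<alpha> k \<in> {0<..\<alpha>bar}) \<longrightarrow>
           filterlim (\<lambda>n. \<Sum>k<n. \<alpha> k) at_top sequentially \<longrightarrow>
           (\<exists>k. near_approx_stationary \<epsilon> \<delta> (total_field N D g) (x k))"
proof -
  interpret prr_setting N f D g
    by unfold_locales (use assms(1-9) in auto)
  obtain m where m: "\<And>x. ereal m \<le> total_objective N f g x" using assms(10) by blast
  have "m \<le> F x" if "x \<in> effective_domain g" for x
    using m[of x] total_objective_eq_F[OF that] by simp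
  then show ?thesis
    using assms(11-14) unfolding effective_domain_total_objective
    by (rule prr_reaches_near_stationary)
qed

end
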